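(* Let $d\ge 2k$. For each $\mathfrak{m}\in\mathcal{P}_2(2k)$ one has the formal expansion in powers of $d^{-1}$ $$(-1)^{|\mathfrak{m}|}\,d^{|\mathfrak{m}|+k}\,\mathrm{Wg}^{\mathrm{O}}(\mathfrak{m},d)=\sum_{g\ge0}\#P(\mathfrak{m},|\mathfrak{m}|+g)\,(-d)^{-g}.$$
   Context: $\mathcal{P}_2(2k)$ is the set of pair partitions of $\{1,\dots,2k\}$; $\mathcal{P}_2(0)=\{\emptyset\}$. $S_{2k}$ acts on $\mathcal{P}_2(2k)$ by applying the permutation to every element of every block. The coset-type of $\mathfrak{m}\in\mathcal{P}_2(2k)$ is the partition $\mu$ of $k$ such that the connected components of the graph on $\{1,\dots,2k\}$ with edges the blocks of $\mathfrak{e}_k=\{1,2\}\{3,4\}\cdots\{2k-1,2k\}$ together with the blocks of $\mathfrak{m}$ have sizes $2\mu_1,2\mu_2,\dots$; $|\mathfrak{m}|=k-\ell(\mu)$ where $\ell(\mu)$ is the number of parts. For integers $d\ge2k$, $\mathrm{Wg}^{\mathrm{O}}(\mathfrak{m},d)=\int_{\mathrm{O}(d)}u_{i_1j_1}\cdots u_{i_{2k}j_{2k}}\,d\mu(U)$ where $\mu$ is normalized Haar measure on $\mathrm{O}(d)$, $\mathbf{i}\in\{1,\dots,d\}^{2k}$ satisfies ($i_r=i_s\iff\{r,s\}\in\mathfrak{e}_k$) for $r\neq s$, and $\mathbf{j}$ satisfies ($j_r=j_s\iff\{r,s\}\in\mathfrak{m}$) for $r\ne s$. The orthogonal Weingarten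 graph has vertex set $\bigsqcup_{k\ge0}\mathcal{P}_2(2k)$, a solid arrow $\mathfrak{m}\to(i,2k-1).\mathfrak{m}$ for every $\mathfrak{m}\in\mathcal{P}_2(2k)$ and $1\le i<2k-1$, and a dashed arrow $\mathfrak{m}\dashrightarrow\mathfrak{m}^{\downarrow}$ whenever $\{2k-1,2k\}\in\mathfrak{m}$, with $\mathfrak{m}^{\downarrow}\in\mathcal{P}_2(2k-2)$ being $\mathfrak{m}$ with that block removed. $P(\mathfrak{m},l)$ is the set of paths $(\mathfrak{m}_0=\mathfrak{m},\dots,\mathfrak{m}_{l+k}=\emptyset)$ following arrows at each step, using $l$ solid and $k$ dashed arrows. *)

theory Defs
  imports
    "HOL-Probability.Probability"
    "HOL-Library.Disjoint_Sets"
    "HOL-Library.Multiset"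
    "HOL-Combinatorics.Transposition"
begin

definition pair_partitions :: "nat \<Rightarrow> nat set set set" where
  "pair_partitions k = {m. partition_on {1..2*k} m \<and> (\<forall>b\<in>m. card b = 2)}"

definition perm_action :: "(nat \<Rightarrow> nat) \<Rightarrow> nat set set \<Rightarrow> nat set set" where
  "perm_action \<sigma> m = (\<lambda>b. \<sigma> ` b) ` m"

definition base_pairing :: "nat \<Rightarrow> nat set set" where
  "base_pairing k = (\<lambda>r. {2*r - 1, 2*r}) ` {1..k}"

text \<open>Connected components of the graph on \<open>{1..2*k}\<close> whose edges are the blocks of
  the base pairing together with the blocks of \<open>m\<close>. The relation is symmetric, so its
  reflexive transitive closure is the connectedness relation.\<close>

definition pairing_components :: "nat \<Rightarrow> nat set set \<Rightarrow> nat set set" where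
  "pairing_components k m =
     {1..2*k} // {(a, b). {a, b} \<in> base_pairing k \<union> m}\<^sup>*"

text \<open>The coset-type, an integer partition of \<open>k\<close>, as the multiset of its parts; its
  number of parts is the size of the multiset.\<close>

definition coset_type :: "nat \<Rightarrow> nat set set \<Rightarrow> nat multiset" where
  "coset_type k m = image_mset (\<lambda>C. card C div 2) (mset_set (pairing_components k m))"

definition pairing_norm :: "nat \<Rightarrow> nat set set \<Rightarrow> nat" where
  "pairing_norm k m = k - size (coset_type k m)"

text \<open>Normalized Haar measure on \<open>O(d)\<close>, \<open>d = CARD('n)\<close>: a left-invariant Borel
  probability measure. As the group is compact, such a measure is unique and also
  right-invariant.\<close>

definition haar_orthogonal :: "(real^'n^'n) measure \<Rightarrow> bool" where
  "haar_orthogonal M \<longleftrightarrow>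
     sets M = sets (restrict_space borel {U. orthogonal_matrix U}) \<and>
     prob_space M \<and>
     (\<forall>V. orthogonal_matrix V \<longrightarrow> distr M M (\<lambda>U. V ** U) = M)"

definition index_matches :: "nat \<Rightarrow> nat set set \<Rightarrow> (nat \<Rightarrow> 'n) \<Rightarrow> bool" where
  "index_matches k m i \<longleftrightarrow>
     (\<forall>r\<in>{1..2*k}. \<forall>s\<in>{1..2*k}. r \<noteq> s \<longrightarrow> (i r = i s \<longleftrightarrow> {r, s} \<in> m))"

text \<open>The integral does not depend on the index sequences subject to the two matching
  conditions; the Weingarten function is its common value. Admissible sequences exist as
  soon as \<open>k \<le> CARD('n)\<close>.\<close>

definition Wg_O :: "(real^'n^'n) measure \<Rightarrow> nat \<Rightarrow> nat set set \<Rightarrow> real" where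
  "Wg_O M k m =
     (THE w. \<forall>i j. index_matches k (base_pairing k) i \<and> index_matches k m j \<longrightarrow>
        (LINT U|M. (\<Prod>r=1..2*k. U $ i r $ j r)) = w)"

text \<open>Vertices of the Weingarten graph are the pair partitions themselves: the sets
  \<open>pair_partitions k\<close> are pairwise disjoint. There is at most one arrow from one vertex
  to another: distinct \<open>i\<close> give distinct targets of solid arrows, and dashed arrows
  lower \<open>k\<close>. Hence a path is determined by its sequence of vertices.\<close>

definition solid_arrow :: "nat set set \<Rightarrow> nat set set \<Rightarrow> bool" where
  "solid_arrow m m' \<longleftrightarrow>
     (\<exists>k i. m \<in> pair_partitions k \<and> 1 \<le> i \<and> i < 2*k - 1 \<and>
        m' = perm_action (Transposition.transpose i (2*k - 1)) m)"

definition dashed_arrow :: "nat set set \<Rightarrow> nat set set \<Rightarrow> bool" where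
  "dashed_arrow m m' \<longleftrightarrow>
     (\<exists>k\<ge>1. m \<in> pair_partitions k \<and> {2*k - 1, 2*k} \<in> m \<and> m' = m - {{2*k - 1, 2*k}})"

definition weingarten_paths :: "nat \<Rightarrow> nat set set \<Rightarrow> nat \<Rightarrow> nat set set list set" where
  "weingarten_paths k m l =
     {p. length p = l + k + 1 \<and> p ! 0 = m \<and> p ! (l + k) = {} \<and>
         (\<forall>t<l+k. solid_arrow (p ! t) (p ! (t + 1)) \<or> dashed_arrow (p ! t) (p ! (t + 1))) \<and>
         card {t. t < l + k \<and> solid_arrow (p ! t) (p ! (t + 1))} = l \<and>
         card {t. t < l + k \<and> dashed_arrow (p ! t) (p ! (t + 1))} = k}"

end

theory Submission
  imports Defs
begin

text \<open>Write \<open>\<tau>\<^sub>i\<close> for the transposition of \<open>i\<close> and \<open>2*k - 1\<close>. Splitting off the first step of a path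
  shows that \<open>w m = (\<Sum>l. #P(m, l) * (- 1 / d) ^ l) / d ^ k\<close> satisfies
  \<open>d * w m + (\<Sum>i. w (\<tau>\<^sub>i m)) = w (m\<down>)\<close>, where the right-hand side is 0 if \<open>{2*k - 1, 2*k} \<notin> m\<close>;
  the series converges absolutely because there are \<open>2*k - 2 < d\<close> summands. The moments
  satisfy the same recurrence: sum over the row index shared by the last two factors, use that the
  columns are orthonormal, and resolve the resulting moments with four entries in one row by
  a rotation of two rows. As the recurrence has only one bounded solution, the two
  sides agree. Finally, a solid arrow lowers \<open>|m|\<close> by at most 1 and a dashed arrow never lowers it,
  so the series starts at \<open>l = |m|\<close>.\<close>

subsection \<open>Pair partitions and arrows\<close>

lemma pair_partitionsD:
  assumes "m \<in> pair_partitions k"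
  shows pair_partitions_Union: "\<Union>m = {1..2*k}"
    and pair_partitions_card: "\<And>b. b \<in> m \<Longrightarrow> card b = 2"
    and pair_partitions_disjoint: "\<And>b c. b \<in> m \<Longrightarrow> c \<in> m \<Longrightarrow> b \<noteq> c \<Longrightarrow> b \<inter> c = {}"
  using assms by (auto simp: pair_partitions_def partition_on_def disjoint_def)

lemma pair_partitionsI:
  assumes "\<Union>m = {1..2*k}" "\<And>b. b \<in> m \<Longrightarrow> card b = 2"
    "\<And>b c. b \<in> m \<Longrightarrow> c \<in> m \<Longrightarrow> b \<noteq> c \<Longrightarrow> b \<inter> c = {}"
  shows "m \<in> pair_partitions k"
proof -
  have "{} \<notin> m"
    using assms(2) by force
  then show ?thesis
    using assms by (simp add: pair_partitions_def partition_on_def disjoint_def)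
qed

lemma pair_partitions_unique:
  assumes "m \<in> pair_partitions k" "m \<in> pair_partitions k'"
  shows "k = k'"
proof -
  have "{1..2*k} = {1..2*k'}"
    using assms by (metis pair_partitions_Union)
  then have "card {1..2*k} = card {1..2*k'}" by (rule arg_cong)
  then show ?thesis by simp
qed

lemma finite_pair_partitions: "finite (pair_partitions k)"
proof (rule finite_subset)
  show "pair_partitions k \<subseteq> Pow (Pow {1..2*k})"
    using pair_partitions_Union by blast
qed simp

lemma pair_partitions_0: "pair_partitions 0 = {{}}"
proof -
  have "m = {}" if "m \<in> pair_partitions 0" for m
  proof -
    have "b = {}" if "b \<in> m" for b
      using pair_partitions_Union[OF \<open>m \<in> pair_partitions 0\<close>] that by auto
    then show ?thesis
      using pair_partitions_card[OF that] by (metis card.empty equals0I zero_neq_numeral)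
  qed
  then show ?thesis
    by (auto intro!: pair_partitionsI)
qed

lemma pair_partitions_empty_iff: "{} \<in> pair_partitions k \<longleftrightarrow> k = 0"
  using pair_partitions_unique pair_partitions_0 by blast

lemma pair_partitions_block:
  assumes "m \<in> pair_partitions k" "{r, s} \<in> m"
  shows "r \<noteq> s" "r \<in> {1..2*k}" "s \<in> {1..2*k}"
  using pair_partitions_Union[OF assms(1)] pair_partitions_card[OF assms] assms(2) by auto

lemma pair_partitions_block_unique:
  assumes "m \<in> pair_partitions k" "{r, s} \<in> m" "{r, t} \<in> m"
  shows "s = t"
proof -
  have "{r, s} = {r, t}"
    using pair_partitions_disjoint[OF assms] by auto
  then show ?thesis by (metis doubleton_eq_iff)
qed

lemma pair_partitions_partner:
  assumes "m \<in> pair_partitions k" "r \<in> {1..2*k}"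
  obtains s where "{r, s} \<in> m"
proof -
  obtain b where b: "b \<in> m" "r \<in> b"
    using assms pair_partitions_Union by blast
  then obtain x y where "b = {x, y}"
    using pair_partitions_card[OF assms(1)] card_2_iff by metis
  then show ?thesis
    using b that by (metis empty_iff insert_commute insert_iff)
qed

text \<open>For an involution the inverse image of a block is its image, which turns membership in
  the target into membership in \<open>m\<close>.\<close>

lemma doubleton_in_perm_action:
  assumes "\<And>x. \<sigma> (\<sigma> x) = x"
  shows "{r, s} \<in> perm_action \<sigma> m \<longleftrightarrow> {\<sigma> r, \<sigma> s} \<in> m"
proof -
  have *: "\<sigma> ` \<sigma> ` b = b" for b
    using assms by (simp add: image_image)
  show ?thesis
  proof
    assume "{r, s} \<in> perm_action \<sigma> m"
    then obtain b where "b \<in> m" "{r, s} = \<sigma> ` b"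
      by (auto simp: perm_action_def)
    then show "{\<sigma> r, \<sigma> s} \<in> m"
      using *[of b] by (metis image_empty image_insert)
  next
    assume "{\<sigma> r, \<sigma> s} \<in> m"
    then have "\<sigma> ` {\<sigma> r, \<sigma> s} \<in> perm_action \<sigma> m"
      unfolding perm_action_def by blast
    then show "{r, s} \<in> perm_action \<sigma> m"
      using assms by simp
  qed
qed

lemma perm_action_pair_partitions:
  assumes "m \<in> pair_partitions k" "inj \<sigma>" "\<sigma> ` {1..2*k} = {1..2*k}"
  shows "perm_action \<sigma> m \<in> pair_partitions k"
proof (rule pair_partitionsI)
  show "\<Union>(perm_action \<sigma> m) = {1..2*k}"
    unfolding perm_action_def using pair_partitions_Union[OF assms(1)] assms(3)
    by (metis image_Union)
  show "card b = 2" if "b \<in> perm_action \<sigma> m" for b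
    using that pair_partitions_card[OF assms(1)] assms(2)
    by (auto simp: perm_action_def card_image inj_on_subset)
  show "b \<inter> c = {}" if "b \<in> perm_action \<sigma> m" "c \<in> perm_action \<sigma> m" "b \<noteq> c" for b c
  proof -
    obtain b' c' where "b' \<in> m" "c' \<in> m" "b = \<sigma> ` b'" "c = \<sigma> ` c'"
      using \<open>b \<in> _\<close> \<open>c \<in> _\<close> unfolding perm_action_def by (elim imageE)
    moreover have "b' \<inter> c' = {}"
      using calculation that(3) by (intro pair_partitions_disjoint[OF assms(1)]) auto
    ultimately show ?thesis
      by (metis image_Int[OF assms(2)] image_empty)
  qed
qed

abbreviation solid_target :: "nat \<Rightarrow> nat set set \<Rightarrow> nat \<Rightarrow> nat set set" where
  "solid_target k m i \<equiv> perm_action (Transposition.transpose i (2*k - 1)) m"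

abbreviation dashed_target :: "nat \<Rightarrow> nat set set \<Rightarrow> nat set set" where
  "dashed_target k m \<equiv> m - {{2*k - 1, 2*k}}"

lemma solid_target_pair_partitions:
  assumes "m \<in> pair_partitions k" "i \<in> {1..<2*k - 1}"
  shows "solid_target k m i \<in> pair_partitions k"
proof (rule perm_action_pair_partitions[OF assms(1) inj_transpose])
  show "Transposition.transpose i (2*k - 1) ` {1..2*k} = {1..2*k}"
    using assms(2) by (intro transpose_image_eq) auto
qed

lemma dashed_target_pair_partitions:
  assumes "m \<in> pair_partitions k" "{2*k - 1, 2*k} \<in> m"
  shows "dashed_target k m \<in> pair_partitions (k - 1)"
proof (rule pair_partitionsI)
  have k: "k \<ge> 1"
    using pair_partitions_block[OF assms] by auto
  have "\<Union>(dashed_target k m) = \<Union>m - {2*k - 1, 2*k}"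
    using pair_partitions_disjoint[OF assms(1)] assms(2) by blast
  also have "\<dots> = {1..2*(k - 1)}"
    using pair_partitions_Union[OF assms(1)] k by auto
  finally show "\<Union>(dashed_target k m) = {1..2*(k - 1)}" .
qed (use pair_partitions_card[OF assms(1)] pair_partitions_disjoint[OF assms(1)] in auto)

text \<open>The index \<open>i\<close> can be read off from the partner of \<open>2*k - 1\<close> in
  the target: it is the partner of \<open>i\<close> in \<open>m\<close>, or \<open>i\<close> itself
  if \<open>m\<close> pairs \<open>i\<close> with \<open>2*k - 1\<close>. This makes the sets of
  paths with different solid first arrows disjoint.\<close>

lemma inj_on_solid_target:
  assumes m: "m \<in> pair_partitions k"
  shows "inj_on (solid_target k m) {1..<2*k - 1}"
proof (rule inj_onI)
  fix i i' assume i: "i \<in> {1..<2*k - 1}" "i' \<in> {1..<2*k - 1}"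
    and eq: "solid_target k m i = solid_target k m i'"
  obtain p where p: "{i, p} \<in> m"
    by (rule pair_partitions_partner[OF m, of i]) (use i in auto)
  obtain p' where p': "{i', p'} \<in> m"
    by (rule pair_partitions_partner[OF m, of i']) (use i in auto)
  have "{2*k - 1, Transposition.transpose i (2*k - 1) p} \<in> solid_target k m i"
    using p by (simp add: doubleton_in_perm_action)
  moreover have "{2*k - 1, Transposition.transpose i' (2*k - 1) p'} \<in> solid_target k m i"
    unfolding eq using p' by (simp add: doubleton_in_perm_action)
  ultimately have c: "Transposition.transpose i (2*k - 1) p = Transposition.transpose i' (2*k - 1) p'"
    using pair_partitions_block_unique[OF solid_target_pair_partitions[OF m i(1)]] by blast
  have ne: "p \<noteq> i" "p' \<noteq> i'"
    using pair_partitions_block(1)[OF m] p p' by blast+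
  have p2: "{p, i} \<in> m" "{p', i'} \<in> m"
    using p p' by (simp_all add: insert_commute)
  consider "p = 2*k - 1" "p' = 2*k - 1" | "p = 2*k - 1" "p' \<noteq> 2*k - 1"
    | "p \<noteq> 2*k - 1" "p' = 2*k - 1" | "p \<noteq> 2*k - 1" "p' \<noteq> 2*k - 1"
    by blast
  then show "i = i'"
  proof cases
    case 1
    then show ?thesis using c by simp
  next
    case 2
    then have "p' = i" using c ne by simp
    then show ?thesis
      using pair_partitions_block_unique[OF m p p2(2)[unfolded \<open>p' = i\<close>]] 2 i by simp
  next
    case 3
    then have "p = i'" using c ne by simp
    then show ?thesis
      using pair_partitions_block_unique[OF m p' p2(1)[unfolded \<open>p = i'\<close>]] 3 i by simp
  next
    case 4
    then have "p = p'" using c ne by simp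
    then show ?thesis
      using pair_partitions_block_unique[OF m p2(1), of i'] p2(2) by simp
  qed
qed

lemma solid_arrow_iff:
  assumes m: "m \<in> pair_partitions k"
  shows "solid_arrow m m' \<longleftrightarrow> m' \<in> solid_target k m ` {1..<2*k - 1}"
proof
  assume "solid_arrow m m'"
  then obtain k' i where k': "m \<in> pair_partitions k'" "1 \<le> i" "i < 2*k' - 1" "m' = solid_target k' m i"
    unfolding solid_arrow_def by (elim exE conjE)
  then have "k' = k"
    using m pair_partitions_unique by metis
  then show "m' \<in> solid_target k m ` {1..<2*k - 1}"
    using k' by simp
next
  assume "m' \<in> solid_target k m ` {1..<2*k - 1}"
  then obtain i where "i \<in> {1..<2*k - 1}" "m' = solid_target k m i"
    by (rule imageE)
  then show "solid_arrow m m'"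
    unfolding solid_arrow_def using m by (intro exI[of _ k] exI[of _ i]) simp
qed

lemma dashed_arrow_iff:
  assumes m: "m \<in> pair_partitions k"
  shows "dashed_arrow m m' \<longleftrightarrow> {2*k - 1, 2*k} \<in> m \<and> m' = dashed_target k m"
proof
  assume "dashed_arrow m m'"
  then obtain k' where k': "m \<in> pair_partitions k'" "{2*k' - 1, 2*k'} \<in> m" "m' = dashed_target k' m"
    unfolding dashed_arrow_def by (elim exE conjE)
  moreover have "k' = k"
    using k'(1) m by (rule pair_partitions_unique)
  ultimately show "{2*k - 1, 2*k} \<in> m \<and> m' = dashed_target k m"
    by simp
next
  assume r: "{2*k - 1, 2*k} \<in> m \<and> m' = dashed_target k m"
  moreover have "1 \<le> k"
    using pair_partitions_block(2)[OF m conjunct1[OF r]] by simp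
  ultimately show "dashed_arrow m m'"
    unfolding dashed_arrow_def using m by (intro exI[of _ k]) simp
qed

text \<open>A solid arrow keeps \<open>k\<close> while a dashed arrow lowers it, so each step of a
  path enters exactly one of the two counts in \<open>weingarten_paths\<close>.\<close>

lemma not_solid_and_dashed:
  assumes "m \<in> pair_partitions k" "dashed_arrow m m'"
  shows "\<not> solid_arrow m m'"
proof
  assume "solid_arrow m m'"
  then obtain i where "i \<in> {1..<2*k - 1}" "m' = solid_target k m i"
    unfolding solid_arrow_iff[OF assms(1)] by (rule imageE)
  then have 1: "m' \<in> pair_partitions k"
    using solid_target_pair_partitions[OF assms(1)] by simp
  have d: "{2*k - 1, 2*k} \<in> m" "m' = dashed_target k m"
    using assms(2) unfolding dashed_arrow_iff[OF assms(1)] by simp_all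
  have 2: "m' \<in> pair_partitions (k - 1)"
    unfolding d(2) using assms(1) d(1) by (rule dashed_target_pair_partitions)
  have "k \<ge> 1"
    using pair_partitions_block[OF assms(1) d(1)] by auto
  moreover have "k = k - 1"
    using 1 2 by (rule pair_partitions_unique)
  ultimately show False by linarith
qed

subsection \<open>Counting paths\<close>

lemma card_less_Suc_shift:
  "card {t. t < Suc n \<and> P t} = (if P 0 then 1 else 0) + card {t. t < n \<and> P (Suc t)}"
proof -
  have "{t. t < Suc n \<and> P t} = (if P 0 then {0} else {}) \<union> Suc ` {t. t < n \<and> P (Suc t)}"
    by (auto simp: image_iff less_Suc_eq_0_disj)
  then show ?thesis
    by (auto simp: card_Un_disjoint card_image)
qed

text \<open>The starting vertex is left free, so that a path and its tail can be compared without
  naming where they begin.\<close>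

definition path_of :: "nat set set list \<Rightarrow> nat \<Rightarrow> nat \<Rightarrow> bool" where
  "path_of p k l \<longleftrightarrow> length p = l + k + 1 \<and> p ! (l + k) = {} \<and>
     (\<forall>t<l+k. solid_arrow (p ! t) (p ! (t + 1)) \<or> dashed_arrow (p ! t) (p ! (t + 1))) \<and>
     card {t. t < l + k \<and> solid_arrow (p ! t) (p ! (t + 1))} = l \<and>
     card {t. t < l + k \<and> dashed_arrow (p ! t) (p ! (t + 1))} = k"

lemma weingarten_paths_iff: "p \<in> weingarten_paths k m l \<longleftrightarrow> path_of p k l \<and> p ! 0 = m"
  by (auto simp: weingarten_paths_def path_of_def)

lemma path_of_Cons:
  assumes "m \<in> pair_partitions k"
  shows "path_of (m # m' # q) k l \<longleftrightarrow>
    solid_arrow m m' \<and> 1 \<le> l \<and> path_of (m' # q) k (l - 1) \<or>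
    dashed_arrow m m' \<and> path_of (m' # q) (k - 1) l"
proof -
  define n where "n = length q"
  define P where "P \<longleftrightarrow> (m' # q) ! n = {} \<and> (\<forall>t<n. solid_arrow ((m' # q) ! t) ((m' # q) ! (t + 1)) \<or>
    dashed_arrow ((m' # q) ! t) ((m' # q) ! (t + 1)))"
  define S where "S = card {t. t < n \<and> solid_arrow ((m' # q) ! t) ((m' # q) ! (t + 1))}"
  define D where "D = card {t. t < n \<and> dashed_arrow ((m' # q) ! t) ((m' # q) ! (t + 1))}"
  have tail: "path_of (m' # q) k' l' \<longleftrightarrow> n = l' + k' \<and> P \<and> S = l' \<and> D = k'" for k' l'
    unfolding path_of_def P_def S_def D_def n_def by auto
  have head: "path_of (m # m' # q) k l \<longleftrightarrow> Suc n = l + k \<and> (solid_arrow m m' \<or> dashed_arrow m m') \<and> P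
      \<and> (if solid_arrow m m' then 1 else 0) + S = l \<and> (if dashed_arrow m m' then 1 else 0) + D = k"
  proof (cases "l + k = Suc n")
    case True
    show ?thesis
      unfolding path_of_def True card_less_Suc_shift All_less_Suc2 P_def S_def D_def
      by (auto simp: n_def)
  next
    case False
    then show ?thesis
      by (auto simp: path_of_def n_def)
  qed
  \<comment> \<open>A dashed arrow exists only for positive \<open>k\<close>, so
    \<open>k - 1\<close> is not truncated, just as \<open>1 \<le> l\<close> guards
    \<open>l - 1\<close>.\<close>
  have "1 \<le> k" if "dashed_arrow m m'"
    using that assms pair_partitions_unique unfolding dashed_arrow_def by blast
  then show ?thesis
    using not_solid_and_dashed[OF assms, of m'] unfolding tail head by auto
qed

definition num_paths :: "nat \<Rightarrow> nat set set \<Rightarrow> nat \<Rightarrow> nat" where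
  "num_paths k m l = card (weingarten_paths k m l)"

text \<open>No arrow leaves the empty pairing, so only the trivial path starts there.\<close>

lemma weingarten_paths_0: "weingarten_paths 0 {} l = (if l = 0 then {[{}]} else {})"
proof -
  have "weingarten_paths 0 {} 0 = {[{}]}"
    by (auto simp: weingarten_paths_def length_Suc_conv)
  moreover have False if "p \<in> weingarten_paths 0 {} l" "l \<noteq> 0" for p
  proof -
    have "solid_arrow {} (p ! 1) \<or> dashed_arrow {} (p ! 1)"
      using that by (auto simp: weingarten_paths_def)
    then show False
      by (auto simp: solid_arrow_def dashed_arrow_def pair_partitions_empty_iff)
  qed
  ultimately show ?thesis by auto
qed

lemma weingarten_paths_rec:
  assumes m: "m \<in> pair_partitions k" and k: "1 \<le> k"
  shows "weingarten_paths k m l =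
    (\<Union>i\<in>(if l = 0 then {} else {1..<2*k - 1}). (#) m ` weingarten_paths k (solid_target k m i) (l - 1))
    \<union> (if {2*k - 1, 2*k} \<in> m then (#) m ` weingarten_paths (k - 1) (dashed_target k m) l else {})"
    (is "_ = ?S \<union> ?D")
proof (intro equalityI subsetI)
  fix p assume p: "p \<in> weingarten_paths k m l"
  then have len: "length p = l + k + 1" "p ! 0 = m"
    by (auto simp: weingarten_paths_def)
  then obtain m' q where pq: "p = m # m' # q"
    using k by (cases p; cases "tl p") auto
  then have "path_of (m # m' # q) k l"
    using p weingarten_paths_iff by blast
  then show "p \<in> ?S \<union> ?D"
    unfolding path_of_Cons[OF m] solid_arrow_iff[OF m] dashed_arrow_iff[OF m] pq
    by (auto simp: weingarten_paths_iff image_iff)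
next
  fix p assume p: "p \<in> ?S \<union> ?D"
  then obtain p' where p': "p = m # p'" and
    "(1 \<le> l \<and> (\<exists>i\<in>{1..<2*k - 1}. p' \<in> weingarten_paths k (solid_target k m i) (l - 1)))
      \<or> ({2*k - 1, 2*k} \<in> m \<and> p' \<in> weingarten_paths (k - 1) (dashed_target k m) l)"
    by (auto split: if_splits)
  then have "(1 \<le> l \<and> (\<exists>i\<in>{1..<2*k - 1}. path_of p' k (l - 1) \<and> p' ! 0 = solid_target k m i))
      \<or> ({2*k - 1, 2*k} \<in> m \<and> path_of p' (k - 1) l \<and> p' ! 0 = dashed_target k m)"
    by (auto simp: weingarten_paths_iff)
  moreover have "p' \<noteq> []"
    using calculation by (auto simp: path_of_def)
  then obtain m' q where "p' = m' # q"
    by (cases p') auto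
  ultimately show "p \<in> weingarten_paths k m l"
    unfolding weingarten_paths_iff p'
    by (auto simp: path_of_Cons[OF m] solid_arrow_iff[OF m] dashed_arrow_iff[OF m])
qed

text \<open>Every arrow uses up one unit of \<open>k + l\<close>, which is why the induction is on
  this sum.\<close>

lemma finite_weingarten_paths:
  "m \<in> pair_partitions k \<Longrightarrow> finite (weingarten_paths k m l)"
proof (induction "k + l" arbitrary: k l m rule: less_induct)
  case less
  show ?case
  proof (cases "k = 0")
    case True
    then show ?thesis
      using less.prems by (simp add: pair_partitions_0 weingarten_paths_0)
  next
    case False
    then have k: "1 \<le> k" by simp
    show ?thesis
      unfolding weingarten_paths_rec[OF less.prems k]
      using less.prems k
      by (auto simp del: One_nat_def intro!: finite_imageI less.hyps
          solid_target_pair_partitions dashed_target_pair_partitions)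
  qed
qed

lemma num_paths_0: "num_paths 0 {} l = (if l = 0 then 1 else 0)"
  by (simp add: num_paths_def weingarten_paths_0)

lemma num_paths_rec:
  assumes m: "m \<in> pair_partitions k" and k: "1 \<le> k"
  shows "num_paths k m l =
    (if l = 0 then 0 else \<Sum>i\<in>{1..<2*k - 1}. num_paths k (solid_target k m i) (l - 1))
    + (if {2*k - 1, 2*k} \<in> m then num_paths (k - 1) (dashed_target k m) l else 0)"
proof -
  let ?I = "if l = 0 then {} else {1..<2*k - 1}"
  let ?S = "\<lambda>i. (#) m ` weingarten_paths k (solid_target k m i) (l - 1)"
  let ?D = "if {2*k - 1, 2*k} \<in> m then (#) m ` weingarten_paths (k - 1) (dashed_target k m) l else {}"
  have I: "i \<in> {1..<2*k - 1}" if "i \<in> ?I" for i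
    using that by (auto split: if_splits)
  have finS: "finite (?S i)" if "i \<in> ?I" for i
    using I[OF that] m by (intro finite_imageI finite_weingarten_paths solid_target_pair_partitions)
  have finD: "finite ?D"
    using m by (auto simp del: One_nat_def intro!: finite_imageI finite_weingarten_paths
        dashed_target_pair_partitions)
  \<comment> \<open>The second vertex reveals the first arrow; this separates the solid pieces from
    each other and from the dashed piece.\<close>
  have nth1S: "p ! 1 = solid_target k m i" if "p \<in> ?S i" for p i
    using that by (auto simp: weingarten_paths_iff)
  have "?S i \<inter> ?S i' = {}" if "i \<in> ?I" "i' \<in> ?I" "i \<noteq> i'" for i i'
    using inj_onD[OF inj_on_solid_target[OF m] _ I[OF that(1)] I[OF that(2)]] that(3) nth1S
    by blast
  then have cS: "card (\<Union>i\<in>?I. ?S i) = (\<Sum>i\<in>?I. card (?S i))"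
    using finS by (intro card_UN_disjoint) auto
  have disj: "(\<Union>i\<in>?I. ?S i) \<inter> ?D = {}"
  proof (rule ccontr)
    assume "(\<Union>i\<in>?I. ?S i) \<inter> ?D \<noteq> {}"
    then obtain p i where p: "i \<in> ?I" "p \<in> ?S i" "p \<in> ?D"
      by blast
    then have "p ! 1 = dashed_target k m" "{2*k - 1, 2*k} \<in> m"
      by (auto simp: weingarten_paths_iff split: if_splits)
    then have "solid_arrow m (p ! 1)" "dashed_arrow m (p ! 1)"
      using nth1S[OF p(2)] I[OF p(1)] solid_arrow_iff[OF m] dashed_arrow_iff[OF m] by auto
    then show False
      using not_solid_and_dashed[OF m] by blast
  qed
  have "num_paths k m l = card ((\<Union>i\<in>?I. ?S i) \<union> ?D)"
    unfolding num_paths_def weingarten_paths_rec[OF m k, of l] ..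
  also have "\<dots> = card (\<Union>i\<in>?I. ?S i) + card ?D"
    using finS finD disj by (intro card_Un_disjoint) auto
  also have "\<dots> = (\<Sum>i\<in>?I. num_paths k (solid_target k m i) (l - 1)) + card ?D"
    unfolding cS by (simp add: num_paths_def card_image)
  finally show ?thesis
    by (auto simp: num_paths_def card_image)
qed

text \<open>The bound for \<open>k\<close> solves \<open>K = C + 2 * (k - 1) / d * K\<close>, where \<open>C\<close> is the bound for
  \<open>k - 1\<close>.\<close>

lemma num_paths_sum_bounded:
  fixes d :: real
  assumes "2 * real k \<le> d" "0 < d"
  shows "\<exists>C\<ge>0. \<forall>m\<in>pair_partitions k. \<forall>L. (\<Sum>l<L. real (num_paths k m l) / d ^ l) \<le> C"
  using assms(1)
proof (induction k)
  case 0
  have "(\<Sum>l<L. real (num_paths 0 {} l) / d ^ l) = (\<Sum>l<L. if l = 0 then 1 else 0)" for L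
    by (intro sum.cong) (simp_all add: num_paths_0)
  then have "(\<Sum>l<L. real (num_paths 0 {} l) / d ^ l) \<le> 1" for L
    by simp
  then show ?case
    by (intro exI[of _ 1]) (simp add: pair_partitions_0)
next
  case (Suc k)
  \<comment> \<open>At \<open>Suc k\<close> there are \<open>2 * k\<close> solid arrows, at most
    \<open>d - 2\<close>; the strict inequality keeps the denominator of \<open>K\<close>
    positive.\<close>
  then have d: "2 * real k < d" by simp
  obtain C where C: "C \<ge> 0"
      "\<And>m L. m \<in> pair_partitions k \<Longrightarrow> (\<Sum>l<L. real (num_paths k m l) / d ^ l) \<le> C"
    using Suc by auto
  define K where "K = C * d / (d - 2 * real k)"
  have K: "K \<ge> 0" "K = C + 2 * real k / d * K"
    using C(1) d assms(2) by (auto simp: K_def field_simps)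
  \<comment> \<open>Partial sums are bounded because convergence is not known yet. A solid first
    step shortens the sum by one term, so the induction on \<open>L\<close> closes.\<close>
  have "(\<Sum>l<L. real (num_paths (Suc k) m l) / d ^ l) \<le> K" if "m \<in> pair_partitions (Suc k)" for m L
    using that
  proof (induction L arbitrary: m)
    case 0
    then show ?case using K(1) by simp
  next
    case (Suc L)
    let ?m = "dashed_target (Suc k) m" and ?t = "solid_target (Suc k) m"
    define I where "I = {1..<2*Suc k - 1}"
    have I: "card I = 2*k"
      by (simp add: I_def)
    have *: "num_paths (Suc k) m l =
        (if l = 0 then 0 else \<Sum>i\<in>I. num_paths (Suc k) (?t i) (l - 1))
        + (if {2*Suc k - 1, 2*Suc k} \<in> m then num_paths k ?m l else 0)" for l
      using num_paths_rec[OF Suc.prems, of l] by (simp add: I_def)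
    have dashed: "(\<Sum>l<Suc L. real (if {2*Suc k - 1, 2*Suc k} \<in> m then num_paths k ?m l else 0) / d ^ l) \<le> C"
    proof (cases "{2*Suc k - 1, 2*Suc k} \<in> m")
      case True
      then show ?thesis
        using C(2)[of ?m "Suc L"] dashed_target_pair_partitions[OF Suc.prems] by simp
    next
      case False
      then show ?thesis using C(1) by simp
    qed
    have "(\<Sum>l<Suc L. real (if l = 0 then 0 else \<Sum>i\<in>I. num_paths (Suc k) (?t i) (l - 1)) / d ^ l)
      = (\<Sum>l<L. \<Sum>i\<in>I. real (num_paths (Suc k) (?t i) l) / d ^ l / d)"
      by (simp only: sum.lessThan_Suc_shift) (simp add: sum_divide_distrib mult.commute)
    also have "\<dots> = (\<Sum>i\<in>I. (\<Sum>l<L. real (num_paths (Suc k) (?t i) l) / d ^ l) / d)"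
      by (subst sum.swap) (simp add: sum_divide_distrib)
    also have "\<dots> \<le> (\<Sum>i\<in>I. K / d)"
      using Suc.IH solid_target_pair_partitions[OF Suc.prems] assms(2)
      by (intro sum_mono divide_right_mono) (auto simp: I_def)
    also have "\<dots> = 2 * real k / d * K"
      by (simp add: I)
    finally show ?case
      unfolding * of_nat_add add_divide_distrib sum.distrib using dashed K(2) by linarith
  qed
  then show ?case using K(1) by blast
qed

section \<open>The generating series of the path numbers\<close>

definition path_series :: "real \<Rightarrow> nat \<Rightarrow> nat set set \<Rightarrow> real" where
  "path_series d k m = (\<Sum>l. real (num_paths k m l) * (- 1 / d) ^ l)"

text \<open>The absolute values of the terms are \<open>num_paths k m l / d ^ l\<close>, whose
  partial sums are bounded.\<close>

lemma path_series_sums: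
  fixes d :: real
  assumes "2 * real k \<le> d" "0 < d" "m \<in> pair_partitions k"
  shows "(\<lambda>l. real (num_paths k m l) * (- 1 / d) ^ l) sums path_series d k m"
proof -
  obtain C where "\<And>L. (\<Sum>l<L. real (num_paths k m l) / d ^ l) \<le> C"
    using num_paths_sum_bounded[OF assms(1,2)] assms(3) by blast
  then have "summable (\<lambda>l. real (num_paths k m l) / d ^ l)"
    using assms(2) by (intro summableI_nonneg_bounded[where x = C]) simp_all
  moreover have "\<bar>real (num_paths k m l) * (- 1 / d) ^ l\<bar> = real (num_paths k m l) / d ^ l" for l
  proof -
    have "\<bar>(- 1 / d) ^ l\<bar> = 1 / d ^ l"
      using assms(2) by (simp add: power_abs power_one_over)
    then show ?thesis
      by (simp only: abs_mult) simp
  qed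
  ultimately have "summable (\<lambda>l. real (num_paths k m l) * (- 1 / d) ^ l)"
    using summable_rabs_cancel[of "\<lambda>l. real (num_paths k m l) * (- 1 / d) ^ l"] by (simp only:)
  then show ?thesis
    unfolding path_series_def by (rule summable_sums)
qed

lemma path_series_0: "path_series d 0 {} = 1"
proof -
  have "path_series d 0 {} = (\<Sum>l\<in>{0}. real (num_paths 0 {} l) * (- 1 / d) ^ l)"
    unfolding path_series_def by (rule suminf_finite) (auto simp: num_paths_0)
  then show ?thesis by (simp add: num_paths_0)
qed

text \<open>The recurrence of the path numbers is summed against powers of \<open>- 1 / d\<close>:
  \<open>s\<close> collects the paths that begin with a solid arrow and \<open>t\<close> those that
  begin with a dashed one. A solid first step costs one factor \<open>- 1 / d\<close>; multiplying
  by \<open>d\<close> brings these terms to the left with a plus sign.\<close>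

lemma path_series_rec:
  fixes d :: real
  assumes "2 * real k \<le> d" "0 < d" and m: "m \<in> pair_partitions k" and k: "1 \<le> k"
  shows "d * path_series d k m + (\<Sum>i\<in>{1..<2*k - 1}. path_series d k (solid_target k m i)) =
    (if {2*k - 1, 2*k} \<in> m then d * path_series d (k - 1) (dashed_target k m) else 0)"
proof -
  let ?z = "- 1 / d"
  let ?F = "\<lambda>i. path_series d k (solid_target k m i)"
  define s where "s l = real (if l = 0 then 0 else
    \<Sum>i\<in>{1..<2*k - 1}. num_paths k (solid_target k m i) (l - 1)) * ?z ^ l" for l
  define t where "t = (\<lambda>l. real (if {2*k - 1, 2*k} \<in> m then num_paths (k - 1) (dashed_target k m) l else 0)
    * ?z ^ l)"
  have "(\<lambda>l. ?z * (\<Sum>i\<in>{1..<2*k - 1}. real (num_paths k (solid_target k m i) l) * ?z ^ l)) sums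
    (?z * (\<Sum>i\<in>{1..<2*k - 1}. ?F i))"
    using assms(1,2) solid_target_pair_partitions[OF m]
    by (intro sums_mult sums_sum path_series_sums)
  then have "(\<lambda>l. s (Suc l)) sums (?z * (\<Sum>i\<in>{1..<2*k - 1}. ?F i))"
    by (simp add: s_def sum_distrib_left mult_ac)
  then have "s sums (?z * (\<Sum>i\<in>{1..<2*k - 1}. ?F i) + s 0)"
    by (rule sums_Suc)
  moreover have "s 0 = 0"
    by (simp add: s_def)
  moreover have "t sums (if {2*k - 1, 2*k} \<in> m then path_series d (k - 1) (dashed_target k m) else 0)"
  proof (cases "{2*k - 1, 2*k} \<in> m")
    case True
    have "2 * real (k - 1) \<le> d"
      using assms(1) by linarith
    from path_series_sums[OF this assms(2) dashed_target_pair_partitions[OF m True]]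
    show ?thesis
      unfolding t_def by (simp only: True if_True)
  next
    case False
    then show ?thesis
      by (simp add: t_def)
  qed
  moreover have "real (num_paths k m l) * ?z ^ l = s l + t l" for l
    unfolding s_def t_def num_paths_rec[OF m k, of l] of_nat_add distrib_right ..
  ultimately have "(\<lambda>l. real (num_paths k m l) * ?z ^ l) sums (?z * (\<Sum>i\<in>{1..<2*k - 1}. ?F i)
      + (if {2*k - 1, 2*k} \<in> m then path_series d (k - 1) (dashed_target k m) else 0))"
    using sums_add by fastforce
  then have "path_series d k m = ?z * (\<Sum>i\<in>{1..<2*k - 1}. ?F i)
      + (if {2*k - 1, 2*k} \<in> m then path_series d (k - 1) (dashed_target k m) else 0)"
    using path_series_sums[OF assms(1-3)] sums_unique2 by blast
  then show ?thesis
    using assms(2) by (simp add: field_simps del: One_nat_def)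
qed

subsection \<open>Components and the length of paths\<close>

lemma rtrancl_Image_eq:
  assumes "sym R" "(x, y) \<in> R\<^sup>*"
  shows "R\<^sup>* `` {x} = R\<^sup>* `` {y}"
  using assms by (auto intro: rtrancl_trans dest: symD[OF sym_rtrancl])

lemma finite_quotient_rtrancl: "finite A \<Longrightarrow> finite (A // R)"
  by (simp add: quotient_def)

text \<open>Each class for \<open>S\<close> is the \<open>S\<^sup>*\<close>-image of a class for
  \<open>R\<close>, so enlarging the relation cannot create classes.\<close>

lemma card_quotient_antimono:
  assumes "finite A" "R \<subseteq> S\<^sup>*"
  shows "card (A // S\<^sup>*) \<le> card (A // R\<^sup>*)"
proof (rule surj_card_le)
  show "finite (A // R\<^sup>*)"
    using assms(1) by (rule finite_quotient_rtrancl)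
  have "R\<^sup>* \<subseteq> S\<^sup>*"
    using assms(2) rtrancl_subset_rtrancl by blast
  then have "S\<^sup>* `` (R\<^sup>* `` {x}) = S\<^sup>* `` {x}" for x
    by (auto intro: rtrancl_trans)
  then show "A // S\<^sup>* \<subseteq> Image (S\<^sup>*) ` (A // R\<^sup>*)"
    by (auto simp: quotient_def image_iff)
qed

text \<open>A walk that crosses the new edge more than once revisits an endpoint and can be cut
  short, so one crossing suffices.\<close>

lemma rtrancl_insert_edge:
  assumes "(x, y) \<in> (R \<union> {(i, j), (j, i)})\<^sup>*"
  shows "(x, y) \<in> R\<^sup>* \<or> (x, i) \<in> R\<^sup>* \<and> (j, y) \<in> R\<^sup>* \<or> (x, j) \<in> R\<^sup>* \<and> (i, y) \<in> R\<^sup>*"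
  using assms
proof (induction rule: rtrancl_induct)
  case (step y z)
  then consider "(y, z) \<in> R" | "y = i" "z = j" | "y = j" "z = i" by blast
  then show ?case
    using step.IH by cases (blast intro: rtrancl_into_rtrancl)+
qed simp

text \<open>A new edge merges at most the class of \<open>i\<close> with that of \<open>j\<close>.
  Hence passing to the larger classes is injective once the class of \<open>j\<close> is left
  out.\<close>

lemma card_quotient_insert_edge:
  assumes "finite A" "sym R"
  shows "card (A // R\<^sup>*) \<le> card (A // (R \<union> {(i, j), (j, i)})\<^sup>*) + 1"
proof -
  define S where "S = R \<union> {(i, j), (j, i)}"
  have "R\<^sup>* \<subseteq> S\<^sup>*"
    unfolding S_def by (intro rtrancl_mono) blast
  then have cl: "S\<^sup>* `` (R\<^sup>* `` {x}) = S\<^sup>* `` {x}" for x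
    by (auto intro: rtrancl_trans)
  have "inj_on (Image (S\<^sup>*)) (A // R\<^sup>* - {R\<^sup>* `` {j}})"
  proof (rule inj_onI)
    fix C D assume C: "C \<in> A // R\<^sup>* - {R\<^sup>* `` {j}}" and D: "D \<in> A // R\<^sup>* - {R\<^sup>* `` {j}}"
      and eq: "S\<^sup>* `` C = S\<^sup>* `` D"
    obtain x y where x: "C = R\<^sup>* `` {x}" and y: "D = R\<^sup>* `` {y}"
      using C D by (auto elim!: quotientE)
    have "(x, y) \<in> S\<^sup>*"
      using eq unfolding x y cl by (metis Image_singleton_iff rtrancl.rtrancl_refl)
    then have "(x, y) \<in> R\<^sup>* \<or> (j, y) \<in> R\<^sup>* \<or> (x, j) \<in> R\<^sup>*"
      using rtrancl_insert_edge[of x y R i j] unfolding S_def by argo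
    moreover have "(j, y) \<notin> R\<^sup>*"
      using rtrancl_Image_eq[OF assms(2), of j y] D y by auto
    moreover have "(x, j) \<notin> R\<^sup>*"
      using rtrancl_Image_eq[OF assms(2), of x j] C x by auto
    ultimately show "C = D"
      using rtrancl_Image_eq[OF assms(2), of x y] x y by simp
  qed
  then have "card (A // R\<^sup>* - {R\<^sup>* `` {j}}) = card (Image (S\<^sup>*) ` (A // R\<^sup>* - {R\<^sup>* `` {j}}))"
    by (simp add: card_image)
  also have "\<dots> \<le> card (A // S\<^sup>*)"
  proof (rule card_mono)
    show "finite (A // S\<^sup>*)"
      using assms(1) by (rule finite_quotient_rtrancl)
    show "Image (S\<^sup>*) ` (A // R\<^sup>* - {R\<^sup>* `` {j}}) \<subseteq> A // S\<^sup>*"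
      using cl by (auto simp: quotient_def)
  qed
  finally have "card (A // R\<^sup>* - {R\<^sup>* `` {j}}) \<le> card (A // S\<^sup>*)" .
  moreover have "card (A // R\<^sup>*) \<le> card (A // R\<^sup>* - {R\<^sup>* `` {j}}) + 1"
    by (cases "R\<^sup>* `` {j} \<in> A // R\<^sup>*") (simp_all add: card_Diff_singleton)
  ultimately show ?thesis
    unfolding S_def by linarith
qed

definition pairing_rel :: "nat \<Rightarrow> nat set set \<Rightarrow> (nat \<times> nat) set" where
  "pairing_rel k m = {(a, b). {a, b} \<in> base_pairing k \<union> m}"

lemma sym_pairing_rel: "sym (pairing_rel k m)"
  by (auto simp: sym_def pairing_rel_def insert_commute)

lemma pairing_norm_eq: "pairing_norm k m = k - card ({1..2*k} // (pairing_rel k m)\<^sup>*)"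
  by (simp add: pairing_norm_def coset_type_def pairing_components_def pairing_rel_def)

lemma base_pairing_pair_partitions: "base_pairing k \<in> pair_partitions k"
proof (rule pair_partitionsI)
  have "r \<in> \<Union>(base_pairing k)" if "r \<in> {1..2*k}" for r
  proof -
    \<comment> \<open>The block containing \<open>r\<close> has index \<open>r / 2\<close> rounded
      up.\<close>
    have "r \<in> {2 * ((r + 1) div 2) - 1, 2 * ((r + 1) div 2)}" "(r + 1) div 2 \<in> {1..k}"
      using that by auto
    then show ?thesis
      unfolding base_pairing_def by blast
  qed
  then show "\<Union>(base_pairing k) = {1..2*k}"
    by (auto simp: base_pairing_def)
  show "card b = 2" if "b \<in> base_pairing k" for b
    using that by (auto simp: base_pairing_def card_insert_if)
  show "b \<inter> c = {}" if "b \<in> base_pairing k" "c \<in> base_pairing k" "b \<noteq> c" for b c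
  proof -
    obtain r t where r: "1 \<le> r" "b = {2*r - 1, 2*r}" and t: "1 \<le> t" "c = {2*t - 1, 2*t}"
      using \<open>b \<in> _\<close> \<open>c \<in> _\<close> by (auto simp: base_pairing_def)
    moreover have "r \<noteq> t"
      using r t that(3) by blast
    then have "2*r - 1 \<noteq> 2*t - 1" "2*r - 1 \<noteq> 2*t" "2*r \<noteq> 2*t - 1" "2*r \<noteq> 2*t"
      using r(1) t(1) by presburger+
    ultimately show ?thesis by simp
  qed
qed

lemma base_pairing_Suc: "base_pairing (Suc k) = insert {2*k + 1, 2*k + 2} (base_pairing k)"
  by (auto simp: base_pairing_def atLeastAtMostSuc_conv)

text \<open>Once \<open>i\<close> and \<open>2*k - 1\<close> are joined by an edge, \<open>m\<close> and its target have the same components.\<close>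

lemma pairing_norm_solid_target:
  "pairing_norm k m \<le> Suc (pairing_norm k (solid_target k m i))"
proof -
  define \<tau> where "\<tau> = Transposition.transpose i (2*k - 1)"
  let ?S = "pairing_rel k (perm_action \<tau> m) \<union> {(i, 2*k - 1), (2*k - 1, i)}"
  have move: "(a, \<tau> a) \<in> ?S\<^sup>*" "(\<tau> a, a) \<in> ?S\<^sup>*" for a
    by (auto simp: \<tau>_def Transposition.transpose_def)
  \<comment> \<open>A block \<open>{a, b}\<close> of \<open>m\<close> is followed along
    \<open>a\<close>, \<open>\<tau> a\<close>, \<open>\<tau> b\<close>, \<open>b\<close>; the outer
    steps use the added edge or are trivial.\<close>
  have "pairing_rel k m \<subseteq> ?S\<^sup>*"
  proof (intro subrelI)
    fix a b assume "(a, b) \<in> pairing_rel k m"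
    then consider "{a, b} \<in> base_pairing k" | "{a, b} \<in> m"
      by (auto simp: pairing_rel_def)
    then show "(a, b) \<in> ?S\<^sup>*"
    proof cases
      case 1
      then show ?thesis by (auto simp: pairing_rel_def)
    next
      case 2
      then have "{\<tau> a, \<tau> b} \<in> perm_action \<tau> m"
        by (subst doubleton_in_perm_action) (auto simp: \<tau>_def)
      then have "(\<tau> a, \<tau> b) \<in> ?S"
        by (simp add: pairing_rel_def)
      then show ?thesis
        using move by (meson r_into_rtrancl rtrancl_trans)
    qed
  qed
  then have "card ({1..2*k} // ?S\<^sup>*) \<le> card ({1..2*k} // (pairing_rel k m)\<^sup>*)"
    by (intro card_quotient_antimono) auto
  moreover have "card ({1..2*k} // (pairing_rel k (perm_action \<tau> m))\<^sup>*) \<le> card ({1..2*k} // ?S\<^sup>*) + 1"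
    by (intro card_quotient_insert_edge sym_pairing_rel) simp
  ultimately show ?thesis
    unfolding pairing_norm_eq \<tau>_def by linarith
qed

text \<open>The block \<open>{2*k - 1, 2*k}\<close> lies in both pairings and is a component of its
  own. Removing it lowers \<open>k\<close> by one and the number of components by at least one, so
  the difference cannot drop.\<close>

lemma pairing_norm_dashed_target:
  assumes m: "m \<in> pair_partitions k" and d: "{2*k - 1, 2*k} \<in> m"
  shows "pairing_norm k m \<le> pairing_norm (k - 1) (dashed_target k m)"
proof -
  have k: "1 \<le> k"
    using pair_partitions_block(2)[OF m d] by simp
  define m' where "m' = dashed_target k m"
  define R where "R = pairing_rel k m"
  define R' where "R' = pairing_rel (k - 1) m'"
  have m': "m' \<in> pair_partitions (k - 1)"
    unfolding m'_def using m d by (rule dashed_target_pair_partitions)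
  have base: "base_pairing k = insert {2*k - 1, 2*k} (base_pairing (k - 1))"
    using base_pairing_Suc[of "k - 1"] k by (cases k) simp_all
  have "R' \<subseteq> R"
    unfolding R_def R'_def pairing_rel_def m'_def base by auto
  \<comment> \<open>Edges starting among the first \<open>2*(k - 1)\<close> points stay there and
    survive the removal, so these points keep their classes.\<close>
  have R: "(y, z) \<in> R' \<and> z \<in> {1..2*(k - 1)}" if "(y, z) \<in> R" "y \<in> {1..2*(k - 1)}" for y z
  proof -
    have "{y, z} \<noteq> {2*k - 1, 2*k}"
      using that(2) by (auto simp: doubleton_eq_iff)
    then have b: "{y, z} \<in> base_pairing (k - 1) \<or> {y, z} \<in> m'"
      using that(1) unfolding R_def pairing_rel_def m'_def base by auto
    then have "z \<in> {1..2*(k - 1)}"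
      using pair_partitions_block(3)[OF m'] pair_partitions_block(3)[OF base_pairing_pair_partitions]
      by blast
    then show ?thesis
      using b by (auto simp: R'_def pairing_rel_def)
  qed
  have "(x, y) \<in> R'\<^sup>* \<and> y \<in> {1..2*(k - 1)}" if "(x, y) \<in> R\<^sup>*" "x \<in> {1..2*(k - 1)}" for x y
    using that(1)
  proof (induction rule: rtrancl_induct)
    case (step y z)
    then show ?case
      using R[of y z] by (meson rtrancl_into_rtrancl)
  qed (use that(2) in simp)
  moreover have "R'\<^sup>* \<subseteq> R\<^sup>*"
    using \<open>R' \<subseteq> R\<close> by (rule rtrancl_mono)
  ultimately have cl: "R'\<^sup>* `` {x} = R\<^sup>* `` {x}" "R\<^sup>* `` {x} \<subseteq> {1..2*(k - 1)}"
    if "x \<in> {1..2*(k - 1)}" for x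
    using that by blast+
  have quot: "{1..2*(k - 1)} // R'\<^sup>* = (\<lambda>x. R\<^sup>* `` {x}) ` {1..2*(k - 1)}"
    unfolding quotient_def using cl(1) by auto
  \<comment> \<open>The class of \<open>2*k\<close> is the additional one: no class of a remaining
    point contains \<open>2*k\<close>.\<close>
  have "R\<^sup>* `` {2*k} \<noteq> R\<^sup>* `` {x}" if "x \<in> {1..2*(k - 1)}" for x
  proof -
    have "2*k \<notin> R\<^sup>* `` {x}"
      using cl(2)[OF that] k by force
    then show ?thesis by blast
  qed
  then have "R\<^sup>* `` {2*k} \<notin> {1..2*(k - 1)} // R'\<^sup>*"
    unfolding quot by blast
  then have "Suc (card ({1..2*(k - 1)} // R'\<^sup>*)) = card (insert (R\<^sup>* `` {2*k}) ({1..2*(k - 1)} // R'\<^sup>*))"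
    by (simp add: finite_quotient_rtrancl)
  also have "\<dots> \<le> card ({1..2*k} // R\<^sup>*)"
  proof (rule card_mono)
    show "finite ({1..2*k} // R\<^sup>*)"
      by (simp add: finite_quotient_rtrancl)
    have "(\<lambda>x. R\<^sup>* `` {x}) ` {1..2*(k - 1)} \<subseteq> {1..2*k} // R\<^sup>*"
      by (auto intro!: quotientI)
    moreover have "R\<^sup>* `` {2*k} \<in> {1..2*k} // R\<^sup>*"
      using k by (intro quotientI) simp
    ultimately show "insert (R\<^sup>* `` {2*k}) ({1..2*(k - 1)} // R'\<^sup>*) \<subseteq> {1..2*k} // R\<^sup>*"
      unfolding quot by blast
  qed
  finally show ?thesis
    unfolding pairing_norm_eq R_def R'_def m'_def by linarith
qed

lemma num_paths_eq_0:
  "m \<in> pair_partitions k \<Longrightarrow> l < pairing_norm k m \<Longrightarrow> num_paths k m l = 0"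
proof (induction "k + l" arbitrary: k l m rule: less_induct)
  case less
  \<comment> \<open>The norm is at most \<open>k\<close>, so its being above \<open>l\<close> forces
    \<open>k\<close> to be positive and the path recurrence applies.\<close>
  have k: "1 \<le> k"
    using less.prems by (simp add: pairing_norm_def)
  have "num_paths k (solid_target k m i) (l - 1) = 0" if "i \<in> {1..<2*k - 1}" "l \<noteq> 0" for i
  proof (rule less.hyps)
    show "l - 1 < pairing_norm k (solid_target k m i)"
      using pairing_norm_solid_target[of k m i] less.prems(2) that(2) by linarith
  qed (use that less.prems(1) solid_target_pair_partitions in auto)
  moreover have "num_paths (k - 1) (dashed_target k m) l = 0" if d: "{2*k - 1, 2*k} \<in> m"
  proof (rule less.hyps)
    show "dashed_target k m \<in> pair_partitions (k - 1)"
      using less.prems(1) d by (rule dashed_target_pair_partitions)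
    show "l < pairing_norm (k - 1) (dashed_target k m)"
      using pairing_norm_dashed_target[OF less.prems(1) d] less.prems(2) by linarith
  qed (use k in simp)
  ultimately show ?case
    unfolding num_paths_rec[OF less.prems(1) k] by simp
qed

subsection \<open>Moments of Haar measure\<close>

lemma haar_orthogonal_prob: "haar_orthogonal M \<Longrightarrow> prob_space M"
  by (simp add: haar_orthogonal_def)

lemma space_haar_orthogonal:
  assumes "haar_orthogonal M"
  shows "space M = {U. orthogonal_matrix U}"
proof -
  have "sets M = sets (restrict_space borel {U. orthogonal_matrix U})"
    using assms by (simp add: haar_orthogonal_def)
  then show ?thesis
    by (auto dest: sets_eq_imp_space_eq simp: space_restrict_space)
qed

lemma measurable_haar_orthogonal:
  assumes "haar_orthogonal M" "f \<in> borel \<rightarrow>\<^sub>M N"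
  shows "f \<in> M \<rightarrow>\<^sub>M N"
proof -
  have "sets M = sets (restrict_space borel {U. orthogonal_matrix U})"
    using assms by (simp add: haar_orthogonal_def)
  moreover have "f \<in> restrict_space borel {U. orthogonal_matrix U} \<rightarrow>\<^sub>M N"
    using assms(2) by (rule measurable_restrict_space1)
  ultimately show ?thesis
    by (simp cong: measurable_cong_sets)
qed

lemma continuous_on_matrix_mult_left:
  fixes V :: "real^'n^'n"
  shows "continuous_on UNIV (\<lambda>U. V ** U)"
  unfolding matrix_matrix_mult_def by (intro continuous_intros)

text \<open>Left invariance in the form of a substitution. It is stated for continuous integrands
  because the moments to come integrate polynomials in the matrix entries.\<close>

lemma integral_haar_orthogonal:
  fixes M :: "(real^'n^'n) measure" and f :: "real^'n^'n \<Rightarrow> real"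
  assumes M: "haar_orthogonal M" and V: "orthogonal_matrix V" and f: "continuous_on UNIV f"
  shows "(LINT U|M. f (V ** U)) = (LINT U|M. f U)"
proof -
  have "(\<lambda>U. V ** U) \<in> M \<rightarrow>\<^sub>M borel"
    by (intro measurable_haar_orthogonal[OF M] borel_measurable_continuous_onI
        continuous_on_matrix_mult_left)
  then have "(\<lambda>U. V ** U) \<in> M \<rightarrow>\<^sub>M restrict_space borel {U. orthogonal_matrix U}"
    using V by (intro measurable_restrict_space2)
      (auto simp: space_haar_orthogonal[OF M] orthogonal_matrix_mul)
  then have "(\<lambda>U. V ** U) \<in> M \<rightarrow>\<^sub>M M"
    using M by (simp add: haar_orthogonal_def cong: measurable_cong_sets)
  moreover have "f \<in> borel_measurable M"
    using f by (intro measurable_haar_orthogonal[OF M] borel_measurable_continuous_onI)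
  ultimately have "(LINT U|M. f (V ** U)) = (LINT U|distr M M (\<lambda>U. V ** U). f U)"
    by (simp add: integral_distr)
  also have "distr M M (\<lambda>U. V ** U) = M"
    using M V by (simp add: haar_orthogonal_def)
  finally show ?thesis .
qed

lemma norm_row_orthogonal_matrix:
  fixes U :: "real^'n^'n"
  assumes "orthogonal_matrix U"
  shows "norm (U $ i) = 1"
  using assms by (auto simp: orthogonal_matrix_orthonormal_rows row_def vec_nth_inverse)

lemma orthogonal_matrix_entry_le_1:
  fixes U :: "real^'n^'n"
  assumes "orthogonal_matrix U"
  shows "\<bar>U $ i $ j\<bar> \<le> 1"
  using component_le_norm_cart[of "U $ i" j] norm_row_orthogonal_matrix[OF assms] by simp

text \<open>All rows of an orthogonal matrix are unit vectors, so \<open>M\<close> lives on a ball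
  of radius \<open>CARD('n)\<close>, where a continuous function is bounded.\<close>

lemma integrable_haar_orthogonal:
  fixes M :: "(real^'n^'n) measure" and f :: "real^'n^'n \<Rightarrow> real"
  assumes M: "haar_orthogonal M" and f: "continuous_on UNIV f"
  shows "integrable M f"
proof -
  interpret prob_space M
    using M by (rule haar_orthogonal_prob)
  have "norm U \<le> real CARD('n)" if "orthogonal_matrix U" for U :: "real^'n^'n"
  proof -
    have "norm U \<le> (\<Sum>i\<in>UNIV. norm (U $ i))"
      unfolding norm_vec_def by (rule L2_set_le_sum) simp
    then show ?thesis
      using norm_row_orthogonal_matrix[OF that] by simp
  qed
  moreover have "compact (f ` cball 0 (real CARD('n)))"
    using f by (intro compact_continuous_image) (auto intro: continuous_on_subset)
  then obtain B where "\<And>U. U \<in> cball 0 (real CARD('n)) \<Longrightarrow> norm (f U) \<le> B"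
    using compact_imp_bounded bounded_iff by (metis image_eqI)
  ultimately have "AE U in M. norm (f U) \<le> B"
    by (intro AE_I2) (simp add: space_haar_orthogonal[OF M])
  moreover have "f \<in> borel_measurable M"
    using f by (intro measurable_haar_orthogonal[OF M] borel_measurable_continuous_onI)
  ultimately show ?thesis
    by (intro integrable_const_bound)
qed

section \<open>Orthogonality relations and row operations\<close>

lemma orthogonal_matrix_columns:
  fixes U :: "real^'n^'n"
  assumes "orthogonal_matrix U"
  shows "(\<Sum>y\<in>UNIV. U $ y $ c * U $ y $ c') = (if c = c' then 1 else 0)"
proof -
  have "transpose U ** U = mat 1"
    using assms by (simp add: orthogonal_matrix)
  then have "(transpose U ** U) $ c $ c' = (if c = c' then 1 else 0)"
    by (simp add: mat_def)
  then show ?thesis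
    by (simp add: matrix_matrix_mult_def transpose_def)
qed

text \<open>Both row operations below are symmetric involutions, so this criterion covers
  them.\<close>

lemma orthogonal_matrix_involution:
  fixes V :: "real^'n^'n"
  assumes "transpose V = V" "V ** V = mat 1"
  shows "orthogonal_matrix V"
  using assms by (simp add: orthogonal_matrix)

lemma swap_rows:
  fixes a b :: "'n::finite"
  obtains V :: "real^'n^'n" where "orthogonal_matrix V"
    "\<And>(U :: real^'n^'n) x. (V ** U) $ x = U $ (Transposition.transpose a b x)"
proof -
  define V :: "real^'n^'n" where "V = (\<chi> x y. if y = Transposition.transpose a b x then 1 else 0)"
  have row: "(V ** U) $ x = U $ (Transposition.transpose a b x)" for U :: "real^'n^'n" and x
    by (simp add: V_def matrix_matrix_mult_def vec_eq_iff if_distrib[of "\<lambda>t. t * _"] cong: if_cong)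
  have "orthogonal_matrix V"
  proof (rule orthogonal_matrix_involution)
    show "transpose V = V"
      by (auto simp: V_def transpose_def vec_eq_iff)
    show "V ** V = mat 1"
      by (subst vec_eq_iff) (simp add: row, auto simp: V_def mat_def vec_eq_iff)
  qed
  then show thesis
    using row by (rule that)
qed

text \<open>Rows \<open>a\<close> and \<open>b\<close> are mixed by the normalized Hadamard matrix.
  It differs from a rotation by 45 degrees only in the sign of row \<open>b\<close>, and unlike the
  rotation it is its own transpose and inverse.\<close>

lemma reflect_rows:
  fixes a b :: "'n::finite"
  assumes "a \<noteq> b"
  obtains V :: "real^'n^'n" where "orthogonal_matrix V"
    "\<And>(U :: real^'n^'n) c. (V ** U) $ a $ c = (U $ a $ c + U $ b $ c) / sqrt 2"
    "\<And>(U :: real^'n^'n) c. (V ** U) $ b $ c = (U $ a $ c - U $ b $ c) / sqrt 2"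
    "\<And>(U :: real^'n^'n) x. x \<noteq> a \<Longrightarrow> x \<noteq> b \<Longrightarrow> (V ** U) $ x = U $ x"
proof -
  define V :: "real^'n^'n" where "V = (\<chi> x. if x = a then (axis a 1 + axis b 1) /\<^sub>R sqrt 2
    else if x = b then (axis a 1 - axis b 1) /\<^sub>R sqrt 2 else axis x 1)"
  have axis: "(\<Sum>y\<in>UNIV. axis z 1 $ y * u y) = u z" for z :: 'n and u :: "'n \<Rightarrow> real"
    by (simp add: axis_def if_distrib[of "\<lambda>t. t * _"] cong: if_cong)
  have mult: "(V ** U) $ x $ c = (\<Sum>y\<in>UNIV. V $ x $ y * U $ y $ c)" for U :: "real^'n^'n" and x c
    by (simp add: matrix_matrix_mult_def)
  have a: "(V ** U) $ a $ c = (U $ a $ c + U $ b $ c) / sqrt 2" for U :: "real^'n^'n" and c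
    unfolding mult by (simp add: V_def distrib_right add_divide_distrib sum.distrib axis
        mult.assoc divide_inverse flip: sum_distrib_left) (simp add: algebra_simps)
  have b: "(V ** U) $ b $ c = (U $ a $ c - U $ b $ c) / sqrt 2" for U :: "real^'n^'n" and c
    unfolding mult using assms by (simp add: V_def left_diff_distrib sum_subtractf axis
        mult.assoc divide_inverse flip: sum_distrib_left) (simp add: algebra_simps)
  have other: "(V ** U) $ x = U $ x" if "x \<noteq> a" "x \<noteq> b" for U :: "real^'n^'n" and x
    using that by (simp add: vec_eq_iff mult) (simp add: V_def axis)
  have "orthogonal_matrix V"
  proof (rule orthogonal_matrix_involution)
    show "transpose V = V"
      using assms by (auto simp: V_def transpose_def vec_eq_iff axis_def)
    have "(V ** V) $ x $ c = mat 1 $ x $ c" for x c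
      using assms by (cases "x = a"; cases "x = b")
        (auto simp: a b other, auto simp: V_def mat_def axis_def field_simps)
    then show "V ** V = mat 1"
      by (simp add: vec_eq_iff)
  qed
  then show thesis
    using a b other by (rule that)
qed

text \<open>Rotating the rows \<open>a\<close> and \<open>b\<close> by 45 degrees expresses the moment with all four entries in
  row \<open>a\<close> through the three ways of distributing two of them to row \<open>b\<close>; the terms with an odd
  number of entries in row \<open>b\<close> cancel between the two rotated rows.\<close>

lemma four_entries_in_a_row:
  fixes M :: "(real^'n^'n) measure" and R :: "real^'n^'n \<Rightarrow> real" and c1 c2 c3 c4 :: 'n
  assumes M: "haar_orthogonal M" and ab: "a \<noteq> b"
    and R: "continuous_on UNIV R"
    and R_cong: "\<And>U U'. (\<And>x. x \<noteq> a \<Longrightarrow> x \<noteq> b \<Longrightarrow> U $ x = U' $ x) \<Longrightarrow> R U = R U'"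
  defines "I \<equiv> \<lambda>x1 x2 x3 x4. LINT U|M. R U * (U $ x1 $ c1 * U $ x2 $ c2 * (U $ x3 $ c3 * U $ x4 $ c4))"
  shows "I a a a a = I a a b b + I b a a b + I a b a b"
proof -
  define P where "P = (\<lambda>x1 x2 x3 x4 U. R U * (U $ x1 $ c1 * U $ x2 $ c2 * (U $ x3 $ c3 * U $ x4 $ c4)))"
  have I: "I x1 x2 x3 x4 = (LINT U|M. P x1 x2 x3 x4 U)" for x1 x2 x3 x4
    by (simp add: I_def P_def)
  have P_cont: "continuous_on UNIV (P x1 x2 x3 x4)" for x1 x2 x3 x4
    unfolding P_def by (intro continuous_intros R)
  have P_int: "integrable M (P x1 x2 x3 x4)" for x1 x2 x3 x4
    by (rule integrable_haar_orthogonal[OF M P_cont])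
  let ?\<tau> = "Transposition.transpose a b"
  obtain S :: "real^'n^'n" where S: "orthogonal_matrix S"
    "\<And>(U :: real^'n^'n) x. (S ** U) $ x = U $ ?\<tau> x"
    using swap_rows by blast
  \<comment> \<open>The factor \<open>R\<close> sees neither row, so the swap acts on the four row
    indices alone.\<close>
  have "R (S ** U) = R U" for U
    by (rule R_cong) (simp add: S(2))
  then have "P x1 x2 x3 x4 (S ** U) = P (?\<tau> x1) (?\<tau> x2) (?\<tau> x3) (?\<tau> x4) U" for x1 x2 x3 x4 U
    by (simp add: P_def S(2))
  then have swap: "I (?\<tau> x1) (?\<tau> x2) (?\<tau> x3) (?\<tau> x4) = I x1 x2 x3 x4" for x1 x2 x3 x4
    using integral_haar_orthogonal[OF M S(1) P_cont[of x1 x2 x3 x4]] by (simp add: I)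
  obtain V :: "real^'n^'n" where V: "orthogonal_matrix V"
    "\<And>(U :: real^'n^'n) c. (V ** U) $ a $ c = (U $ a $ c + U $ b $ c) / sqrt 2"
    "\<And>(U :: real^'n^'n) c. (V ** U) $ b $ c = (U $ a $ c - U $ b $ c) / sqrt 2"
    "\<And>(U :: real^'n^'n) x. x \<noteq> a \<Longrightarrow> x \<noteq> b \<Longrightarrow> (V ** U) $ x = U $ x"
    using reflect_rows[OF ab] by blast
  have RV: "R (V ** U) = R U" for U
    by (rule R_cong) (simp add: V(4))
  have four: "(p1 / sqrt 2) * (p2 / sqrt 2) * ((p3 / sqrt 2) * (p4 / sqrt 2)) = p1 * p2 * (p3 * p4) / 4"
    for p1 p2 p3 p4 :: real
    by (simp add: field_simps)
  \<comment> \<open>In each product eight of the sixteen terms have an even number of entries from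
    row \<open>b\<close>; they double up, and the factor 1/4 from \<open>four\<close> becomes
    1/2.\<close>
  have "P a a a a (V ** U) + P b b b b (V ** U) =
     (P a a a a U + P b b b b U + (P a a b b U + P b b a a U) + (P a b a b U + P b a b a U)
      + (P a b b a U + P b a a b U)) / 2" for U
    unfolding P_def V(2,3) RV four by (simp add: field_simps)
  then have "(LINT U|M. P a a a a (V ** U) + P b b b b (V ** U)) =
     (LINT U|M. (P a a a a U + P b b b b U + (P a a b b U + P b b a a U) + (P a b a b U + P b a b a U)
      + (P a b b a U + P b a a b U)) / 2)"
    by (simp only:)
  then have "(LINT U|M. P a a a a (V ** U) + P b b b b (V ** U)) =
     (I a a a a + I b b b b + (I a a b b + I b b a a) + (I a b a b + I b a b a)
      + (I a b b a + I b a a b)) / 2"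
    by (simp add: I P_int)
  moreover have "(LINT U|M. P x x x x (V ** U)) = I x x x x" for x
    unfolding I by (rule integral_haar_orthogonal[OF M V(1) P_cont])
  moreover have "integrable M (\<lambda>U. P x x x x (V ** U))" for x
    by (intro integrable_haar_orthogonal[OF M] continuous_on_compose2[OF P_cont]
        continuous_on_matrix_mult_left) simp
  ultimately have "I a a a a + I b b b b =
     (I a a a a + I b b b b + (I a a b b + I b b a a) + (I a b a b + I b a b a)
      + (I a b b a + I b a a b)) / 2"
    by simp
  \<comment> \<open>By symmetry the identity reads \<open>2 * X = X + Y\<close>, with
    \<open>X\<close> the moment in row \<open>a\<close>. Of each mixed pair the member with its
    fourth entry in row \<open>b\<close> is kept, which suits the later transpositions of column
    indices.\<close>
  moreover have "I b b b b = I a a a a" "I b b a a = I a a b b" "I b a b a = I a b a b"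
    "I a b b a = I b a a b"
    using swap[of a a a a] swap[of a a b b] swap[of a b a b] swap[of b a a b] by simp_all
  ultimately show ?thesis by simp
qed

section \<open>Moments with paired row indices and their recurrence\<close>

definition pair_integral :: "(real^'n^'n) measure \<Rightarrow> nat \<Rightarrow> (nat \<Rightarrow> 'n) \<Rightarrow> (nat \<Rightarrow> 'n) \<Rightarrow> real" where
  "pair_integral M k x j =
     (LINT U|M. (\<Prod>r=1..k. U $ x r $ j (2*r - 1) * U $ x r $ j (2*r)))"

lemma continuous_on_pair_product:
  fixes x j :: "nat \<Rightarrow> 'n::finite"
  shows "continuous_on UNIV (\<lambda>U :: real^'n^'n. \<Prod>r\<in>A. U $ x r $ j (2*r - 1) * U $ x r $ j (2*r))"
  by (intro continuous_intros)

text \<open>This bound, uniform in \<open>x\<close> and \<open>j\<close>, singles out the moments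
  among the solutions of the recurrence.\<close>

lemma pair_integral_le_1:
  fixes M :: "(real^'n^'n) measure"
  assumes M: "haar_orthogonal M"
  shows "\<bar>pair_integral M k x j\<bar> \<le> 1"
proof -
  interpret prob_space M
    using M by (rule haar_orthogonal_prob)
  let ?f = "\<lambda>U :: real^'n^'n. \<Prod>r=1..k. U $ x r $ j (2*r - 1) * U $ x r $ j (2*r)"
  have "\<bar>?f U\<bar> \<le> 1" if "orthogonal_matrix U" for U
    unfolding abs_prod abs_mult using orthogonal_matrix_entry_le_1[OF that]
    by (intro prod_le_1) (simp add: mult_le_one)
  then have "(LINT U|M. \<bar>?f U\<bar>) \<le> 1"
    using integrable_haar_orthogonal[OF M continuous_on_pair_product[where A = "{1..k}" and x = x and j = j]]
    by (intro integral_le_const AE_I2) (auto simp: space_haar_orthogonal[OF M])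
  then show ?thesis
    unfolding pair_integral_def using integral_abs_bound[of M ?f] by linarith
qed

text \<open>The rows \<open>y\<close> and \<open>x (Suc k)\<close> do not occur among the first
  \<open>k\<close> pairs, so swapping them leaves the other factors alone.\<close>

lemma pair_integral_replace_row:
  fixes M :: "(real^'n^'n) measure"
  assumes M: "haar_orthogonal M" and "x (Suc k) \<notin> x ` {1..k}" "y \<notin> x ` {1..k}"
  shows "(LINT U|M. (\<Prod>r=1..k. U $ x r $ j (2*r - 1) * U $ x r $ j (2*r))
      * (U $ y $ j (2*k + 1) * U $ y $ j (2*k + 2))) = pair_integral M (Suc k) x j"
proof -
  obtain S :: "real^'n^'n" where S: "orthogonal_matrix S"
    "\<And>(U :: real^'n^'n) z. (S ** U) $ z = U $ Transposition.transpose y (x (Suc k)) z"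
    using swap_rows by blast
  let ?f = "\<lambda>U :: real^'n^'n. (\<Prod>r=1..k. U $ x r $ j (2*r - 1) * U $ x r $ j (2*r))
      * (U $ y $ j (2*k + 1) * U $ y $ j (2*k + 2))"
  have "x r \<noteq> y" "x r \<noteq> x (Suc k)" if "r \<in> {1..k}" for r
    using assms(2,3) that by (metis imageI)+
  then have "?f (S ** U) = (\<Prod>r=1..Suc k. U $ x r $ j (2*r - 1) * U $ x r $ j (2*r))" for U
    by (simp add: S(2))
  moreover have "continuous_on UNIV ?f"
    by (intro continuous_intros)
  ultimately show ?thesis
    using integral_haar_orthogonal[OF M S(1), of ?f] by (simp add: pair_integral_def)
qed

text \<open>Row \<open>x t\<close> carries four entries. Resolving them with the row
  \<open>x (Suc k)\<close> gives three moments with two entries in each of these rows; the last two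
  become pair integrals once the column index at \<open>2*k + 1\<close> is exchanged with the one at
  \<open>2*t - 1\<close> or \<open>2*t\<close>.\<close>

lemma pair_integral_repeated_row:
  fixes M :: "(real^'n^'n) measure"
  assumes M: "haar_orthogonal M" and x: "inj_on x {1..Suc k}" and t: "t \<in> {1..k}"
  shows "(LINT U|M. (\<Prod>r=1..k. U $ x r $ j (2*r - 1) * U $ x r $ j (2*r))
      * (U $ x t $ j (2*k + 1) * U $ x t $ j (2*k + 2))) =
    pair_integral M (Suc k) x j
    + pair_integral M (Suc k) x (j \<circ> Transposition.transpose (2*t - 1) (2*k + 1))
    + pair_integral M (Suc k) x (j \<circ> Transposition.transpose (2*t) (2*k + 1))"
proof -
  let ?a = "x t" and ?b = "x (Suc k)"
  define R where "R = (\<lambda>U :: real^'n^'n. \<Prod>r\<in>{1..k} - {t}. U $ x r $ j (2*r - 1) * U $ x r $ j (2*r))"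
  have ab: "?a \<noteq> ?b"
    using inj_onD[OF x, of t "Suc k"] t by auto
  have ne: "x r \<noteq> ?a" "x r \<noteq> ?b" if "r \<in> {1..k} - {t}" for r
    using inj_onD[OF x, of r t] inj_onD[OF x, of r "Suc k"] that t by auto
  have "continuous_on UNIV R"
    unfolding R_def by (rule continuous_on_pair_product)
  moreover have "R U = R U'" if "\<And>y. y \<noteq> ?a \<Longrightarrow> y \<noteq> ?b \<Longrightarrow> U $ y = U' $ y" for U U'
    unfolding R_def using ne that by (intro prod.cong) auto
  ultimately have *: "(LINT U|M. R U * (U $ ?a $ j (2*t - 1) * U $ ?a $ j (2*t) * (U $ ?a $ j (2*k + 1) * U $ ?a $ j (2*k + 2))))
    = (LINT U|M. R U * (U $ ?a $ j (2*t - 1) * U $ ?a $ j (2*t) * (U $ ?b $ j (2*k + 1) * U $ ?b $ j (2*k + 2))))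
    + (LINT U|M. R U * (U $ ?b $ j (2*t - 1) * U $ ?a $ j (2*t) * (U $ ?a $ j (2*k + 1) * U $ ?b $ j (2*k + 2))))
    + (LINT U|M. R U * (U $ ?a $ j (2*t - 1) * U $ ?b $ j (2*t) * (U $ ?a $ j (2*k + 1) * U $ ?b $ j (2*k + 2))))"
    by (rule four_entries_in_a_row[OF M ab])
  \<comment> \<open>\<open>split\<close> and \<open>E\<close> allow any \<open>j'\<close> that
    agrees with \<open>j\<close> on the other blocks, since they serve \<open>j\<close> and both of
    its transposed versions.\<close>
  have split: "(\<Prod>r=1..k. U $ x r $ j' (2*r - 1) * U $ x r $ j' (2*r))
      = R U * (U $ ?a $ j' (2*t - 1) * U $ ?a $ j' (2*t))"
    if "\<And>r. r \<in> {1..k} - {t} \<Longrightarrow> j' (2*r - 1) = j (2*r - 1) \<and> j' (2*r) = j (2*r)"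
    for j' :: "nat \<Rightarrow> 'n" and U :: "real^'n^'n"
    unfolding R_def using that t by (subst prod.remove[of _ t]) (auto simp: mult.commute intro!: prod.cong)
  have E: "pair_integral M (Suc k) x j' =
      (LINT U|M. R U * (U $ ?a $ j' (2*t - 1) * U $ ?a $ j' (2*t) * (U $ ?b $ j' (2*k + 1) * U $ ?b $ j' (2*k + 2))))"
    if j': "\<And>r. r \<in> {1..k} - {t} \<Longrightarrow> j' (2*r - 1) = j (2*r - 1) \<and> j' (2*r) = j (2*r)"
    for j' :: "nat \<Rightarrow> 'n"
  proof -
    have "(\<Prod>r=1..Suc k. U $ x r $ j' (2*r - 1) * U $ x r $ j' (2*r)) =
      R U * (U $ ?a $ j' (2*t - 1) * U $ ?a $ j' (2*t) * (U $ ?b $ j' (2*k + 1) * U $ ?b $ j' (2*k + 2)))"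
      for U :: "real^'n^'n"
    proof -
      have "(\<Prod>r=1..Suc k. U $ x r $ j' (2*r - 1) * U $ x r $ j' (2*r)) =
        (\<Prod>r=1..k. U $ x r $ j' (2*r - 1) * U $ x r $ j' (2*r))
          * (U $ ?b $ j' (2*k + 1) * U $ ?b $ j' (2*k + 2))"
        by simp
      also have "(\<Prod>r=1..k. U $ x r $ j' (2*r - 1) * U $ x r $ j' (2*r)) =
        R U * (U $ ?a $ j' (2*t - 1) * U $ ?a $ j' (2*t))"
        by (rule split) (rule j')
      finally show ?thesis
        by (simp only: mult.assoc)
    qed
    then show ?thesis
      unfolding pair_integral_def by (simp only:)
  qed
  have tr: "Transposition.transpose s (2*k + 1) (2*r - 1) = 2*r - 1"
    "Transposition.transpose s (2*k + 1) (2*r) = 2*r"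
    if "r \<in> {1..k} - {t}" "s \<in> {2*t - 1, 2*t}" for r s
  proof -
    have "2*r - 1 \<noteq> 2*t - 1" "2*r - 1 \<noteq> 2*t" "2*r \<noteq> 2*t - 1" "2*r \<noteq> 2*t"
        "2*r - 1 \<noteq> 2*k + 1" "2*r \<noteq> 2*k + 1"
      using that(1) t by (auto; presburger)+
    then show "Transposition.transpose s (2*k + 1) (2*r - 1) = 2*r - 1"
      "Transposition.transpose s (2*k + 1) (2*r) = 2*r"
      using that(2) by (auto simp: Transposition.transpose_def)
  qed
  have t': "2*t \<noteq> 2*t - 1" "2*t \<noteq> 2*k + 1" "2*t - 1 \<noteq> 2*k + 1" "2*k + 2 \<noteq> 2*t" "2*k + 2 \<noteq> 2*t - 1"
    using t by auto
  have 1: "pair_integral M (Suc k) x (j \<circ> Transposition.transpose (2*t - 1) (2*k + 1)) =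
    (LINT U|M. R U * (U $ ?b $ j (2*t - 1) * U $ ?a $ j (2*t) * (U $ ?a $ j (2*k + 1) * U $ ?b $ j (2*k + 2))))"
    by (subst E) (use tr t' in \<open>simp_all del: One_nat_def add: mult_ac\<close>)
  have 2: "pair_integral M (Suc k) x (j \<circ> Transposition.transpose (2*t) (2*k + 1)) =
    (LINT U|M. R U * (U $ ?a $ j (2*t - 1) * U $ ?b $ j (2*t) * (U $ ?a $ j (2*k + 1) * U $ ?b $ j (2*k + 2))))"
    by (subst E) (use tr t' in \<open>simp_all del: One_nat_def add: mult_ac\<close>)
  have 0: "pair_integral M (Suc k) x j =
    (LINT U|M. R U * (U $ ?a $ j (2*t - 1) * U $ ?a $ j (2*t) * (U $ ?b $ j (2*k + 1) * U $ ?b $ j (2*k + 2))))"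
    by (rule E) simp
  show ?thesis
    unfolding 0 1 2 split[OF conjI[OF refl refl]] using * by (simp only: mult.assoc)
qed

lemma sum_pairs:
  fixes f :: "nat \<Rightarrow> 'a::comm_monoid_add"
  shows "(\<Sum>i=1..2*k. f i) = (\<Sum>t=1..k. f (2*t - 1) + f (2*t))"
  by (induction k) (simp_all add: add.assoc)

lemma prod_pairs:
  fixes f :: "nat \<Rightarrow> 'a::comm_monoid_mult"
  shows "(\<Prod>i=1..2*k. f i) = (\<Prod>t=1..k. f (2*t - 1) * f (2*t))"
  by (induction k) (simp_all add: mult.assoc)

text \<open>Let the row \<open>y\<close> of the last two factors vary. Every \<open>y\<close>
  contributes the original moment, and each repeated row \<open>x t\<close> contributes two
  transposed moments in addition; together they make up the left-hand side. Summing inside the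
  integral instead leaves the inner product of two columns, which is 1 or 0.\<close>

lemma pair_integral_rec:
  fixes M :: "(real^'n^'n) measure"
  assumes M: "haar_orthogonal M" and x: "inj_on x {1..Suc k}"
  shows "real CARD('n) * pair_integral M (Suc k) x j
    + (\<Sum>i=1..2*k. pair_integral M (Suc k) x (j \<circ> Transposition.transpose i (2*k + 1)))
    = (if j (2*k + 1) = j (2*k + 2) then pair_integral M k x j else 0)"
proof -
  let ?Q = "\<lambda>U :: real^'n^'n. \<Prod>r=1..k. U $ x r $ j (2*r - 1) * U $ x r $ j (2*r)"
  let ?c = "j (2*k + 1)" and ?c' = "j (2*k + 2)"
  define T where "T y = (LINT U|M. ?Q U * (U $ y $ ?c * U $ y $ ?c'))" for y
  define E where "E = pair_integral M (Suc k) x"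
  let ?g = "\<lambda>t. E (j \<circ> Transposition.transpose (2*t - 1) (2*k + 1)) + E (j \<circ> Transposition.transpose (2*t) (2*k + 1))"
  have inj: "inj_on x {1..k}"
    using x by (rule inj_on_subset) auto
  have last: "x (Suc k) \<notin> x ` {1..k}"
    using inj_onD[OF x, of "Suc k"] by fastforce
  have T1: "T y = E j" if "y \<notin> x ` {1..k}" for y
    unfolding T_def E_def using pair_integral_replace_row[OF M last that] .
  have T2: "T (x t) = E j + ?g t" if "t \<in> {1..k}" for t
    unfolding T_def E_def using pair_integral_repeated_row[OF M x that, of j] by (simp only: add.assoc)
  have "(\<Sum>y\<in>UNIV. T y) = (\<Sum>y\<in>UNIV - x ` {1..k}. T y) + (\<Sum>y\<in>x ` {1..k}. T y)"
    by (intro sum.subset_diff) auto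
  also have "(\<Sum>y\<in>UNIV - x ` {1..k}. T y) = (\<Sum>y\<in>UNIV - x ` {1..k}. E j)"
    using T1 by (intro sum.cong) auto
  also have "(\<Sum>y\<in>x ` {1..k}. T y) = (\<Sum>t=1..k. E j + ?g t)"
    unfolding sum.reindex[OF inj] using T2 by (intro sum.cong) auto
  also have "\<dots> = (\<Sum>y\<in>x ` {1..k}. E j) + (\<Sum>t=1..k. ?g t)"
    by (simp only: sum.distrib sum_constant card_image[OF inj])
  also have "(\<Sum>t=1..k. ?g t) = (\<Sum>i=1..2*k. E (j \<circ> Transposition.transpose i (2*k + 1)))"
    by (rule sum_pairs[symmetric])
  finally have "(\<Sum>y\<in>UNIV. T y) = ((\<Sum>y\<in>UNIV - x ` {1..k}. E j) + (\<Sum>y\<in>x ` {1..k}. E j))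
      + (\<Sum>i=1..2*k. E (j \<circ> Transposition.transpose i (2*k + 1)))"
    by (simp only: add.assoc)
  also have "(\<Sum>y\<in>UNIV - x ` {1..k}. E j) + (\<Sum>y\<in>x ` {1..k}. E j) = (\<Sum>y\<in>(UNIV :: 'n set). E j)"
    by (intro sum.subset_diff[symmetric]) auto
  also have "\<dots> = real CARD('n) * E j"
    by simp
  finally have "real CARD('n) * E j + (\<Sum>i=1..2*k. E (j \<circ> Transposition.transpose i (2*k + 1))) = (\<Sum>y\<in>UNIV. T y)"
    by (simp only:)
  also have "\<dots> = (LINT U|M. (\<Sum>y\<in>UNIV. ?Q U * (U $ y $ ?c * U $ y $ ?c')))"
    unfolding T_def by (intro Bochner_Integration.integral_sum[symmetric]
        integrable_haar_orthogonal[OF M] continuous_intros)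
  also have "\<dots> = (LINT U|M. ?Q U * (if ?c = ?c' then 1 else 0))"
    by (intro Bochner_Integration.integral_cong refl)
      (simp add: space_haar_orthogonal[OF M] orthogonal_matrix_columns flip: sum_distrib_left)
  also have "\<dots> = (if ?c = ?c' then pair_integral M k x j else 0)"
    by (simp add: pair_integral_def)
  finally show ?thesis
    unfolding E_def .
qed

subsection \<open>The Weingarten function\<close>

lemma index_matches_solid_target:
  assumes "index_matches k m j" "i \<in> {1..<2*k - 1}"
  shows "index_matches k (solid_target k m i) (j \<circ> Transposition.transpose i (2*k - 1))"
proof -
  define \<tau> where "\<tau> = Transposition.transpose i (2*k - 1)"
  have "\<tau> ` {1..2*k} = {1..2*k}"
    unfolding \<tau>_def using assms(2) by (intro transpose_image_eq) auto
  then have \<tau>: "\<tau> r \<in> {1..2*k}" if "r \<in> {1..2*k}" for r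
    using that by blast
  have inv: "\<tau> (\<tau> r) = r" for r
    by (simp add: \<tau>_def)
  then have "\<tau> r \<noteq> \<tau> s" if "r \<noteq> s" for r s
    using that by metis
  then show ?thesis
    using assms(1) \<tau> unfolding index_matches_def \<tau>_def[symmetric]
    by (simp add: doubleton_in_perm_action[OF inv])
qed

lemma index_matches_dashed_target:
  assumes "index_matches k m j"
  shows "index_matches (k - 1) (dashed_target k m) j"
proof -
  have "{r, t} \<noteq> {2*k - 1, 2*k}" "r \<in> {1..2*k}" if "r \<in> {1..2*(k - 1)}" for r t
    using that by (auto simp: doubleton_eq_iff)
  then show ?thesis
    using assms unfolding index_matches_def by blast
qed

text \<open>An injective labelling of the \<open>2*k\<close> points is made constant on blocks by
  labelling each point through the least element of its block. Without admissible sequences the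
  definite description in \<open>Wg_O\<close> would not single out a value.\<close>

lemma ex_index_matches:
  assumes m: "m \<in> pair_partitions k" and k: "2*k \<le> CARD('n)"
  shows "\<exists>j :: nat \<Rightarrow> 'n::finite. index_matches k m j"
proof -
  have "\<exists>f. f ` {1..2*k} \<subseteq> (UNIV :: 'n set) \<and> inj_on f {1..2*k}"
    using k by (intro card_le_inj) auto
  then obtain f :: "nat \<Rightarrow> 'n" where f: "inj_on f {1..2*k}"
    by blast
  define C where "C r = {t. t = r \<or> {r, t} \<in> m}" for r
  have C: "C r \<subseteq> {1..2*k}" if "r \<in> {1..2*k}" for r
    unfolding C_def using that pair_partitions_block(3)[OF m] by blast
  have Min_C: "Min (C r) \<in> C r" if "r \<in> {1..2*k}" for r
    using C[OF that] by (intro Min_in) (auto intro: finite_subset simp: C_def)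
  have "f (Min (C r)) = f (Min (C t)) \<longleftrightarrow> {r, t} \<in> m"
    if r: "r \<in> {1..2*k}" and t: "t \<in> {1..2*k}" and ne: "r \<noteq> t" for r t
  proof
    assume "f (Min (C r)) = f (Min (C t))"
    then have "Min (C r) = Min (C t)"
      using inj_onD[OF f] Min_C C r t by blast
    then obtain z where z: "z \<in> C r" "z \<in> C t"
      using Min_C r t by metis
    then have "z = r \<or> {z, r} \<in> m" "z = t \<or> {z, t} \<in> m"
      by (auto simp: C_def insert_commute)
    then show "{r, t} \<in> m"
      using ne pair_partitions_block_unique[OF m, of z r t] by (auto simp: insert_commute)
  next
    assume rt: "{r, t} \<in> m"
    then have tr: "{t, r} \<in> m"
      by (simp add: insert_commute)
    have "C r = {r, t}"
      unfolding C_def using rt pair_partitions_block_unique[OF m rt] by blast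
    moreover have "C t = {r, t}"
      unfolding C_def using tr pair_partitions_block_unique[OF m tr] by blast
    ultimately show "f (Min (C r)) = f (Min (C t))"
      by simp
  qed
  then have "index_matches k m (\<lambda>r. f (Min (C r)))"
    by (simp add: index_matches_def)
  then show ?thesis by blast
qed

text \<open>The difference \<open>D\<close> of both sides satisfies the homogeneous recurrence
  \<open>d * D m j = - (\<Sum>i. D (\<tau>\<^sub>i m) (j \<circ> \<tau>\<^sub>i))\<close>. There are fewer than \<open>d\<close> summands, so \<open>D\<close> vanishes.
  This also shows that the integral does not depend on \<open>x\<close> and \<open>j\<close>, without appealing to
  right invariance.\<close>

lemma pair_integral_eq_path_series:
  fixes M :: "(real^'n^'n) measure"
  assumes M: "haar_orthogonal M"
  shows "m \<in> pair_partitions k \<Longrightarrow> 2*k \<le> CARD('n) \<Longrightarrow> inj_on x {1..k} \<Longrightarrow> index_matches k m j \<Longrightarrow>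
    pair_integral M k x j = path_series (real CARD('n)) k m / real CARD('n) ^ k"
proof (induction k arbitrary: m j)
  case 0
  interpret prob_space M
    using M by (rule haar_orthogonal_prob)
  show ?case
    using 0 by (simp add: pair_partitions_0 pair_integral_def path_series_0 prob_space)
next
  case (Suc k)
  define d where "d = real CARD('n)"
  define I where "I = {1..2*k}"
  have d: "0 < d" "2 * real (Suc k) \<le> d" "2 * real k < d"
    using Suc.prems(2) by (simp_all add: d_def)
  have I: "{1..<2*k + 1} = I" "2*Suc k - 1 = 2*k + 1" "2*Suc k = 2*k + 2" "Suc k - 1 = k" "card I = 2*k"
    by (auto simp: I_def)
  define \<tau> where "\<tau> i = Transposition.transpose i (2*k + 1)" for i
  define A where "A = {(m, j). m \<in> pair_partitions (Suc k) \<and> index_matches (Suc k) m (j :: nat \<Rightarrow> 'n)}"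
  define w where "w m = path_series d (Suc k) m / d ^ Suc k" for m
  define D where "D m j = pair_integral M (Suc k) x j - w m" for m j
  \<comment> \<open>The recurrence moves \<open>m\<close> and \<open>j\<close> together, so the
    decay estimate has to run over all matching pairs.\<close>
  have closed: "(perm_action (\<tau> i) m, j \<circ> \<tau> i) \<in> A" if "(m, j) \<in> A" "i \<in> I" for m j i
  proof -
    have i: "i \<in> {1..<2*Suc k - 1}"
      unfolding I(2) unfolding I(1) by (rule that(2))
    show ?thesis
      using that(1) index_matches_solid_target[OF _ i] solid_target_pair_partitions[OF _ i]
      unfolding A_def \<tau>_def I(2)[symmetric] by blast
  qed
  have inj: "inj_on x {1..k}"
    using Suc.prems(3) by (rule inj_on_subset) auto
  have D_rec: "d * D m j = - (\<Sum>i\<in>I. D (perm_action (\<tau> i) m) (j \<circ> \<tau> i))" if "(m, j) \<in> A" for m j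
  proof -
    have m: "m \<in> pair_partitions (Suc k)" and j: "index_matches (Suc k) m j"
      using that by (auto simp: A_def)
    have "d * path_series d (Suc k) m + (\<Sum>i\<in>I. path_series d (Suc k) (perm_action (\<tau> i) m)) =
        (if {2*k + 1, 2*k + 2} \<in> m then d * path_series d k (m - {{2*k + 1, 2*k + 2}}) else 0)"
      using path_series_rec[OF d(2,1) m] unfolding I(2) unfolding I \<tau>_def by simp
    then have "(d * path_series d (Suc k) m + (\<Sum>i\<in>I. path_series d (Suc k) (perm_action (\<tau> i) m))) / d ^ Suc k =
        (if {2*k + 1, 2*k + 2} \<in> m then d * path_series d k (m - {{2*k + 1, 2*k + 2}}) else 0) / d ^ Suc k"
      by (simp only:)
    then have w: "d * w m + (\<Sum>i\<in>I. w (perm_action (\<tau> i) m)) =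
        (if {2*k + 1, 2*k + 2} \<in> m then path_series d k (m - {{2*k + 1, 2*k + 2}}) / d ^ k else 0)"
      using d(1) by (simp add: w_def add_divide_distrib sum_divide_distrib split: if_splits)
    \<comment> \<open>Since \<open>j\<close> matches \<open>m\<close>, the last two column indices
      agree exactly when the block that a dashed arrow removes is present.\<close>
    have j_eq: "j (2*k + 1) = j (2*k + 2) \<longleftrightarrow> {2*k + 1, 2*k + 2} \<in> m"
      using j by (auto simp: index_matches_def)
    have IH: "pair_integral M k x j = path_series d k (m - {{2*k + 1, 2*k + 2}}) / d ^ k"
      if *: "{2*k + 1, 2*k + 2} \<in> m"
      unfolding d_def
    proof (rule Suc.IH)
      show "m - {{2*k + 1, 2*k + 2}} \<in> pair_partitions k"
        using dashed_target_pair_partitions[OF m] * unfolding I(2) unfolding I by simp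
      show "index_matches k (m - {{2*k + 1, 2*k + 2}}) j"
        using index_matches_dashed_target[OF j] unfolding I(2) unfolding I .
    qed (use inj Suc.prems(2) in auto)
    have "d * pair_integral M (Suc k) x j + (\<Sum>i\<in>I. pair_integral M (Suc k) x (j \<circ> \<tau> i))
      = (if {2*k + 1, 2*k + 2} \<in> m then pair_integral M k x j else 0)"
      using pair_integral_rec[OF M Suc.prems(3), of j] unfolding d_def I_def \<tau>_def j_eq .
    also have "\<dots> = d * w m + (\<Sum>i\<in>I. w (perm_action (\<tau> i) m))"
      unfolding w using IH by presburger
    finally show ?thesis
      by (simp add: D_def right_diff_distrib sum_subtractf)
  qed
  \<comment> \<open>The recurrence has \<open>2 * k\<close> terms against a factor \<open>d\<close>,
    so each use of it shrinks a uniform bound by \<open>q\<close>.\<close>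
  define q where "q = 2 * real k / d"
  have q: "0 \<le> q" "q < 1"
    using d by (auto simp: q_def)
  \<comment> \<open>\<open>B\<close> bounds \<open>D\<close> at the start: 1 for the moment, and the
    finite sum for every \<open>w m\<close>.\<close>
  define B where "B = 1 + (\<Sum>m\<in>pair_partitions (Suc k). \<bar>w m\<bar>)"
  have decay: "\<bar>D m j\<bar> \<le> B * q ^ n" if "(m, j) \<in> A" for m j n
    using that
  proof (induction n arbitrary: m j)
    case 0
    then have "\<bar>w m\<bar> \<le> (\<Sum>m\<in>pair_partitions (Suc k). \<bar>w m\<bar>)"
      by (intro member_le_sum) (auto simp: A_def finite_pair_partitions)
    then show ?case
      using pair_integral_le_1[OF M, of "Suc k" x j] by (simp add: D_def B_def)
  next
    case (Suc n)
    have "d * \<bar>D m j\<bar> = \<bar>d * D m j\<bar>"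
      using d(1) by (simp add: abs_mult)
    also have "\<dots> \<le> (\<Sum>i\<in>I. \<bar>D (perm_action (\<tau> i) m) (j \<circ> \<tau> i)\<bar>)"
      unfolding D_rec[OF Suc.prems] by simp
    also have "\<dots> \<le> (\<Sum>i\<in>I. B * q ^ n)"
      by (intro sum_mono Suc.IH closed[OF Suc.prems])
    also have "\<dots> = d * (B * q ^ Suc n)"
      using d(1) by (simp add: I q_def)
    finally show ?case
      using d(1) by simp
  qed
  have "(\<lambda>n. B * q ^ n) \<longlonglongrightarrow> B * 0"
    using q by (intro tendsto_mult_left LIMSEQ_realpow_zero)
  then have "\<bar>D m j\<bar> \<le> 0"
    using decay Suc.prems(1,4) by (intro LIMSEQ_le_const) (auto simp: A_def)
  then show ?case
    by (simp add: D_def w_def d_def)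
qed

text \<open>The row sequence is constant on the blocks of the base pairing, so its values at even
  positions determine it; hence \<open>pair_integral\<close> takes one row index per block.\<close>

lemma integral_eq_pair_integral:
  fixes M :: "(real^'n^'n) measure"
  assumes "index_matches k (base_pairing k) i"
  shows "(LINT U|M. (\<Prod>r=1..2*k. U $ i r $ j r)) = pair_integral M k (\<lambda>t. i (2*t)) j"
proof -
  have eq: "i (2*t - 1) = i (2*t)" if "t \<in> {1..k}" for t
  proof -
    have "{2*t - 1, 2*t} \<in> base_pairing k"
      using that unfolding base_pairing_def by blast
    moreover have "2*t - 1 \<in> {1..2*k}" "2*t \<in> {1..2*k}" "2*t - 1 \<noteq> 2*t"
      using that by auto
    ultimately show ?thesis
      using assms unfolding index_matches_def by blast
  qed
  have "(\<Prod>r=1..2*k. U $ i r $ j r) = (\<Prod>t=1..k. U $ i (2*t) $ j (2*t - 1) * U $ i (2*t) $ j (2*t))"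
    for U :: "real^'n^'n"
    unfolding prod_pairs using eq by (intro prod.cong refl) (simp only:)
  then show ?thesis
    unfolding pair_integral_def by (simp only:)
qed

text \<open>Every block of the base pairing contains an odd number, so distinct even positions never
  match.\<close>

lemma inj_on_index_matches_base:
  assumes "index_matches k (base_pairing k) i"
  shows "inj_on (\<lambda>t. i (2*t)) {1..k}"
proof (rule inj_onI)
  fix r t assume r: "r \<in> {1..k}" "t \<in> {1..k}" "i (2*r) = i (2*t)"
  show "r = t"
  proof (rule ccontr)
    assume "r \<noteq> t"
    then have "{2*r, 2*t} \<in> base_pairing k"
      using assms r by (auto simp: index_matches_def)
    then obtain u where "1 \<le> u" "{2*r, 2*t} = {2*u - 1, 2*u}"
      by (auto simp: base_pairing_def)
    then have "2*r = 2*u - 1 \<or> 2*t = 2*u - 1"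
      by (auto simp: doubleton_eq_iff)
    then show False
      using \<open>1 \<le> u\<close> by presburger
  qed
qed

lemma Wg_O_eq_path_series:
  fixes M :: "(real^'n^'n) measure"
  assumes M: "haar_orthogonal M" and k: "2*k \<le> CARD('n)" and m: "m \<in> pair_partitions k"
  shows "Wg_O M k m = path_series (real CARD('n)) k m / real CARD('n) ^ k"
proof -
  have eq: "(LINT U|M. (\<Prod>r=1..2*k. U $ i r $ j r)) = path_series (real CARD('n)) k m / real CARD('n) ^ k"
    if "index_matches k (base_pairing k) i" "index_matches k m j" for i j
    unfolding integral_eq_pair_integral[OF that(1)]
    using pair_integral_eq_path_series[OF M m k inj_on_index_matches_base[OF that(1)] that(2)] .
  obtain i j :: "nat \<Rightarrow> 'n" where "index_matches k (base_pairing k) i" "index_matches k m j"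
    using ex_index_matches[OF m k] ex_index_matches[OF base_pairing_pair_partitions k] by blast
  then show ?thesis
    unfolding Wg_O_def using eq by (intro the_equality) blast+
qed

theorem theorem4p6:
  fixes M :: "(real^'n^'n) measure" and k :: nat and m :: "nat set set"
  assumes "haar_orthogonal M"
    and "2 * k \<le> CARD('n)"
    and "m \<in> pair_partitions k"
  shows "(\<lambda>g. real (card (weingarten_paths k m (pairing_norm k m + g)))
              * (- real CARD('n)) powi (- int g))
         sums
         ((-1) ^ pairing_norm k m * real CARD('n) ^ (pairing_norm k m + k) * Wg_O M k m)"
proof -
  define d where "d = real CARD('n)"
  have d: "0 < d" "2 * real k \<le> d"
    using assms(2) unfolding d_def by simp_all
  let ?n = "pairing_norm k m"
  let ?f = "\<lambda>l. real (num_paths k m l) * (- 1 / d) ^ l"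
  have "(\<lambda>g. ?f (g + ?n)) sums (path_series d k m - (\<Sum>l<?n. ?f l))"
    using path_series_sums[OF d(2,1) assms(3)] by (rule sums_split_initial_segment)
  also have "(\<Sum>l<?n. ?f l) = 0"
    using num_paths_eq_0[OF assms(3)] by (intro sum.neutral) simp
  finally have "(\<lambda>g. (- d) ^ ?n * ?f (g + ?n)) sums ((- d) ^ ?n * path_series d k m)"
    by (intro sums_mult) simp
  \<comment> \<open>The prefactor cancels the first \<open>?n\<close> of the factors
    \<open>- 1 / d\<close>.\<close>
  moreover have "(- d) ^ ?n * ?f (g + ?n) =
      real (card (weingarten_paths k m (?n + g))) * (- d) powi (- int g)" for g
  proof -
    have "(- d) ^ ?n * (- 1 / d) ^ ?n = 1"
      using d(1) by (simp flip: power_mult_distrib)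
    moreover have "(- d) powi (- int g) = (- 1 / d) ^ g"
      by (simp add: power_int_minus power_one_over divide_inverse flip: power_inverse)
    ultimately show ?thesis
      by (simp only: num_paths_def power_add add.commute[of g] mult_ac) (simp add: mult_ac)
  qed
  \<comment> \<open>The prefactor splits into a sign and a power of \<open>d\<close>, and
    \<open>d ^ k\<close> clears the denominator in \<open>Wg_O_eq_path_series\<close>.\<close>
  moreover have "(- d) ^ ?n * path_series d k m = (-1) ^ ?n * d ^ (?n + k) * Wg_O M k m"
    using d(1) Wg_O_eq_path_series[OF assms] power_minus[of d ?n] by (simp add: d_def power_add)
  ultimately show ?thesis
    by (simp only: d_def)
qed

end
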